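(* Let $B>0$ and let $\phi\in L^2(\mathbb{R})$ be such that $\mathcal{A}\phi(0,\omega)\neq 0$ for almost every $\omega\in(-2B,2B)$. Then for all $f,g\in\mathrm{PW}^2_B$ that are real-valued on the real line, the following are equivalent: (1) $f=\pm g$; (2) $|\mathcal{V}_\phi f(x,\omega)|=|\mathcal{V}_\phi g(x,\omega)|$ for all $x,\omega\in\mathbb{R}$.
   Context: For $B>0$, the Paley--Wiener space is $\mathrm{PW}^2_B:=\{f:\mathbb{C}\to\mathbb{C} \mid \exists F\in L^2([-B,B])\ \forall z\in\mathbb{C}: f(z)=\int_{-B}^B F(\xi)e^{2\pi i \xi z}\,d\xi\}$; its elements are identified with their restrictions to $\mathbb{R}$ (which lie in $L^2(\mathbb{R})$) when transforms are applied. For $f,\phi\in L^2(\mathbb{R})$ the short-time Fourier transform is $\mathcal{V}_\phi f(x,\omega)=\int_{\mathbb{R}} f(t)\overline{\phi(t-x)}e^{-2\pi i t\omega}\,dt$, and the ambiguity function of $f\in L^2(\mathbb{R})$ is $\mathcal{A}f(x,\omega):=e^{\pi i x\omega}\mathcal{V}_f f(x,\omega)$, for $x,\omega\in\mathbb{R}$. *)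

theory Defs
  imports "HOL-Analysis.Analysis"
begin

definition L2_on :: "real set \<Rightarrow> (real \<Rightarrow> complex) \<Rightarrow> bool" where
  "L2_on S F \<longleftrightarrow> (\<lambda>t. indicator S t *\<^sub>R F t) \<in> borel_measurable lebesgue
      \<and> integrable lebesgue (\<lambda>t. indicator S t * (cmod (F t))\<^sup>2)"

abbreviation L2 :: "(real \<Rightarrow> complex) \<Rightarrow> bool" where
  "L2 f \<equiv> L2_on UNIV f"

definition PW2 :: "real \<Rightarrow> (complex \<Rightarrow> complex) set" where
  "PW2 B = {f. \<exists>F. L2_on {-B..B} F \<and>
      (\<forall>z. f z = (LINT \<xi>:{-B..B}|lebesgue. F \<xi> * exp (2 * pi * \<i> * complex_of_real \<xi> * z)))}"

definition stft :: "(real \<Rightarrow> complex) \<Rightarrow> (real \<Rightarrow> complex) \<Rightarrow> real \<Rightarrow> real \<Rightarrow> complex" where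
  "stft \<phi> f x \<omega> = (LINT t|lebesgue. f t * cnj (\<phi> (t - x)) * exp (- 2 * pi * \<i> * complex_of_real (t * \<omega>)))"

definition ambiguity :: "(real \<Rightarrow> complex) \<Rightarrow> real \<Rightarrow> real \<Rightarrow> complex" where
  "ambiguity f x \<omega> = exp (pi * \<i> * complex_of_real (x * \<omega>)) * stft f f x \<omega>"

end

(* Fix x. By Plancherel in omega, the modulus of V_phi f(x, .) determines the integral of
   |f(t)|^2 |phi(t - x)|^2 over t. Taking the Fourier transform in x, the function
   d = |f|^2 - |g|^2 satisfies d^ (eta) * conj (A phi(0, eta)) = 0, so d^ vanishes almost everywhere
   on (-2B, 2B). As f and g are real on the real line, d = f^2 - g^2 there, whose spectrum lies in
   [-2B, 2B]; hence d is orthogonal to f^2 and to g^2, so d = 0. Finally f^2 = g^2 extends from the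
   real line to the plane, and (f - g)(f + g) = 0 forces one of the entire factors to vanish.

   Plancherel's formula for h in L^1 and L^2 is obtained by damping with a Gaussian: the damped
   integral of |h^|^2 is a Gaussian average of ||h||^2 - ||h(. - u) - h||^2 / 2 over u, and
   translation is continuous in L^2. *)

theory Submission
  imports Defs "HOL-Probability.Characteristic_Functions" "HOL-Complex_Analysis.Conformal_Mappings"
begin

section \<open>Continuity of translation\<close>

text \<open>For fixed x the product of f with the shifted window lies in L^1 because both factors
  are in L^2, and in L^2 because f is bounded on the line by the L^1 norm of its spectrum.
  Plancherel's formula on the intersection of L^1 and L^2 therefore suffices, and no transform on
  all of L^2 is constructed. No inversion formula is used either, and d^ is controlled on (-2B, 2B)
  only. If H is the spectrum of f, moving the hat twice turns the pairing of d with f^2 into the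
  double integral of H(\<xi>) H(\<eta>) d^(\<xi> + \<eta>), which sees only sums of two frequencies
  from [-B, B]. This is the origin of the interval in the hypothesis on the window. Real values
  serve twice: |f|^2 = f^2 on the line makes that pairing available, and equality of moduli becomes
  f^2 = g^2, which is an identity between entire functions. The definitions integrate over Lebesgue
  measure while Fubini is applied on products of \<open>lborel\<close>, so each L^2 datum is
  replaced by a Borel function equal to it almost everywhere.\<close>

lemma lborel_integrable_shift_iff:
  fixes f :: "real \<Rightarrow> 'a :: {banach, second_countable_topology}"
  shows "integrable lborel (\<lambda>x. f (x - u)) \<longleftrightarrow> integrable lborel f"
  using lborel_integrable_real_affine_iff[of 1 f "- u"] by simp

lemma lborel_integral_shift:
  fixes f :: "real \<Rightarrow> 'a :: {banach, second_countable_topology}"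
  shows "(LINT x|lborel. f (x - u)) = (LINT x|lborel. f x)"
  using lborel_integral_real_affine[of 1 f "- u"] by simp

lemma lborel_integrable_reflect_iff:
  fixes f :: "real \<Rightarrow> 'a :: {banach, second_countable_topology}"
  shows "integrable lborel (\<lambda>x. f (u - x)) \<longleftrightarrow> integrable lborel f"
  using lborel_integrable_real_affine_iff[of "-1" f u] by simp

lemma lborel_integral_reflect:
  fixes f :: "real \<Rightarrow> 'a :: {banach, second_countable_topology}"
  shows "(LINT x|lborel. f (u - x)) = (LINT x|lborel. f x)"
  using lborel_integral_real_affine[of "-1" f u] by simp

text \<open>Continuity at 0 is phrased through sequences because dominated convergence is applied to
  it.\<close>

definition L1_shift_continuous :: "(real \<Rightarrow> 'a :: {banach, second_countable_topology}) \<Rightarrow> bool" where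
  "L1_shift_continuous f \<longleftrightarrow>
    (\<forall>u. u \<longlonglongrightarrow> 0 \<longrightarrow> (\<lambda>n. LINT x|lborel. norm (f (x - u n) - f x)) \<longlonglongrightarrow> 0)"

text \<open>The approximation error enters at x and at x - u; translation invariance makes both
  contributions equal, hence the factor 2.\<close>

lemma L1_shift_le:
  fixes f g :: "real \<Rightarrow> 'a :: {banach, second_countable_topology}"
  assumes f: "integrable lborel f" and g: "integrable lborel g"
  shows "(LINT x|lborel. norm (f (x - u) - f x)) \<le>
    2 * (LINT x|lborel. norm (f x - g x)) + (LINT x|lborel. norm (g (x - u) - g x))"
proof -
  note sh = lborel_integrable_shift_iff[of _ u]
  have fg: "integrable lborel (\<lambda>x. norm (f x - g x))"
    using f g by auto
  have "(LINT x|lborel. norm (f (x - u) - f x)) \<le>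
     (LINT x|lborel. norm (f (x - u) - g (x - u)) + norm (f x - g x) + norm (g (x - u) - g x))"
  proof (rule integral_mono)
    fix x
    have "f (x - u) - f x = (f (x - u) - g (x - u)) - (f x - g x) + (g (x - u) - g x)" by simp
    then show "norm (f (x - u) - f x) \<le> norm (f (x - u) - g (x - u)) + norm (f x - g x) + norm (g (x - u) - g x)"
      by (smt (verit) norm_triangle_ineq norm_triangle_ineq4)
  qed (use f g fg sh[of f] sh[of g] sh[of "\<lambda>x. norm (f x - g x)"] in auto)
  also have "\<dots> = (LINT x|lborel. norm (f (x - u) - g (x - u))) + (LINT x|lborel. norm (f x - g x))
      + (LINT x|lborel. norm (g (x - u) - g x))"
    using f g fg sh[of f] sh[of g] by simp
  also have "(LINT x|lborel. norm (f (x - u) - g (x - u))) = (LINT x|lborel. norm (f x - g x))"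
    by (rule lborel_integral_shift)
  finally show ?thesis by simp
qed

text \<open>The property is closed under L^1 limits. This serves twice: to pass from open to
  measurable sets, and from simple functions to their limits.\<close>

lemma L1_shift_continuous_approx:
  fixes f :: "real \<Rightarrow> 'a :: {banach, second_countable_topology}"
  assumes f: "integrable lborel f"
    and ex: "\<And>e. e > 0 \<Longrightarrow> \<exists>g. integrable lborel g \<and> L1_shift_continuous g \<and> (LINT x|lborel. norm (f x - g x)) < e"
  shows "L1_shift_continuous f"
  unfolding L1_shift_continuous_def
proof (intro allI impI)
  fix u :: "nat \<Rightarrow> real" assume u: "u \<longlonglongrightarrow> 0"
  show "(\<lambda>n. LINT x|lborel. norm (f (x - u n) - f x)) \<longlonglongrightarrow> 0"
  proof (rule order_tendstoI)
    fix e :: real assume "0 < e"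
    then obtain g where g: "integrable lborel g" "L1_shift_continuous g"
        "(LINT x|lborel. norm (f x - g x)) < e / 4"
      using ex[of "e / 4"] by auto
    then have "(\<lambda>n. LINT x|lborel. norm (g (x - u n) - g x)) \<longlonglongrightarrow> 0"
      using u by (auto simp: L1_shift_continuous_def)
    then have "\<forall>\<^sub>F n in sequentially. (LINT x|lborel. norm (g (x - u n) - g x)) < e / 2"
      using \<open>0 < e\<close> by (intro order_tendstoD(2)) auto
    then show "\<forall>\<^sub>F n in sequentially. (LINT x|lborel. norm (f (x - u n) - f x)) < e"
    proof eventually_elim
      case (elim n)
      then show ?case
        using L1_shift_le[OF f g(1), of "u n"] g(3) by linarith
    qed
  next
    fix e :: real assume "e < 0"
    then show "\<forall>\<^sub>F n in sequentially. e < (LINT x|lborel. norm (f (x - u n) - f x))"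
      by (intro always_eventually allI) (smt (verit) integral_nonneg_AE AE_I2 norm_ge_zero)
  qed
qed

text \<open>The indicator of an open set is lower semicontinuous, so dominated convergence kills the
  positive part of its difference with a translate; the negative part has the same integral.\<close>

lemma L1_shift_continuous_open:
  fixes U :: "real set" and c :: "'a :: {banach, second_countable_topology}"
  assumes U: "open U" "emeasure lborel U < \<infinity>"
  shows "L1_shift_continuous (\<lambda>x. indicator U x *\<^sub>R c)"
  unfolding L1_shift_continuous_def
proof (intro allI impI)
  fix u :: "nat \<Rightarrow> real" assume u: "u \<longlonglongrightarrow> 0"
  define I where "I = (indicator U :: real \<Rightarrow> real)"
  have I: "integrable lborel I"
    using U by (simp add: I_def)
  have Iu: "integrable lborel (\<lambda>x. I (x - u n))" for n
    using I lborel_integrable_shift_iff[of I "u n"] by simp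
  have lim: "(\<lambda>n. LINT x|lborel. max 0 (I x - I (x - u n))) \<longlonglongrightarrow> (LINT (x::real)|lborel. 0)"
  proof (rule integral_dominated_convergence[where w = I])
    show "AE x in lborel. (\<lambda>n. max 0 (I x - I (x - u n))) \<longlonglongrightarrow> 0"
    proof (intro AE_I2)
      fix x :: real
      show "(\<lambda>n. max 0 (I x - I (x - u n))) \<longlonglongrightarrow> 0"
      proof (cases "x \<in> U")
        case True
        have "(\<lambda>n. x - u n) \<longlonglongrightarrow> x"
          using tendsto_diff[OF tendsto_const[of x] u] by simp
        then have "\<forall>\<^sub>F n in sequentially. x - u n \<in> U"
          using U(1) True by (rule topological_tendstoD)
        then have "\<forall>\<^sub>F n in sequentially. max 0 (I x - I (x - u n)) = 0"
          by eventually_elim (simp add: I_def True)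
        then show ?thesis
          by (rule tendsto_eventually)
      next
        case False
        then show ?thesis
          by (simp add: I_def indicator_def)
      qed
    qed
  qed (use I in \<open>auto simp: I_def intro!: borel_measurable_max borel_measurable_diff borel_measurable_integrable[OF Iu[unfolded I_def]] split: split_indicator\<close>)
  have eq: "(LINT x|lborel. norm (I (x - u n) *\<^sub>R c - I x *\<^sub>R c)) =
      2 * norm c * (LINT x|lborel. max 0 (I x - I (x - u n)))" for n
  proof -
    have "(LINT x|lborel. norm (I (x - u n) *\<^sub>R c - I x *\<^sub>R c)) =
      (LINT x|lborel. norm c * (2 * max 0 (I x - I (x - u n)) + (I (x - u n) - I x)))"
      by (intro Bochner_Integration.integral_cong refl) (auto simp: max_def simp flip: scaleR_diff_left)
    also have "\<dots> = norm c * (LINT x|lborel. 2 * max 0 (I x - I (x - u n)) + (I (x - u n) - I x))"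
      by simp
    also have "(LINT x|lborel. 2 * max 0 (I x - I (x - u n)) + (I (x - u n) - I x)) =
        2 * (LINT x|lborel. max 0 (I x - I (x - u n))) + ((LINT x|lborel. I (x - u n)) - (LINT x|lborel. I x))"
      using I Iu[of n] by simp
    also have "(LINT x|lborel. I (x - u n)) = (LINT x|lborel. I x)"
      by (rule lborel_integral_shift)
    finally show ?thesis by simp
  qed
  show "(\<lambda>n. LINT x|lborel. norm (indicator U (x - u n) *\<^sub>R c - indicator U x *\<^sub>R c)) \<longlonglongrightarrow> 0"
    using tendsto_mult_left[OF lim, of "2 * norm c"] eq by (simp add: I_def)
qed

text \<open>Outer regularity reduces the indicator of a measurable set of finite measure to that of
  an open set; sums follow from the triangle inequality and limits by approximation.\<close>

lemma integrable_imp_L1_shift_continuous: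
  fixes f :: "real \<Rightarrow> 'a :: {banach, second_countable_topology}"
  assumes "integrable lborel f"
  shows "L1_shift_continuous f"
  using assms
proof (induction rule: integrable_induct)
  case (base A c)
  show ?case
  proof (rule L1_shift_continuous_approx)
    show "integrable lborel (\<lambda>x. indicator A x *\<^sub>R c)"
      using base by auto
    fix e :: real assume "e > 0"
    \<comment> \<open>The summand 1 keeps the quotient meaningful for c = 0 and the inequality
      \<open>norm c * d < e\<close> strict.\<close>
    define d where "d = e / (norm c + 1)"
    have d: "d > 0" "norm c * d < e"
      using \<open>e > 0\<close> by (auto simp: d_def field_simps add_pos_nonneg add_nonneg_pos)
    obtain U where U: "open U" "A \<subseteq> U" "emeasure lborel (U - A) < ennreal d"
    proof -
      have "A \<in> sets lebesgue" using base by simp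
      then obtain U where "open U" "A \<subseteq> U" "emeasure lebesgue (U - A) < ennreal d"
        using sets_lebesgue_outer_open[of A d] d by metis
      with that base show ?thesis
        by (auto simp: emeasure_completion)
    qed
    have fin: "emeasure lborel U < \<infinity>"
    proof -
      have "emeasure lborel U \<le> emeasure lborel (U - A) + emeasure lborel A"
        using base U(1,2) by (subst plus_emeasure) (auto intro!: emeasure_mono)
      also have "\<dots> < \<infinity>"
        using U(3) base by (auto simp: less_top[symmetric] top_unique)
      finally show ?thesis .
    qed
    have "(LINT x|lborel. norm (indicator A x *\<^sub>R c - indicator U x *\<^sub>R c)) =
        (LINT x|lborel. norm c * indicator (U - A) x)"
      using U(2) by (intro Bochner_Integration.integral_cong refl) (auto simp: indicator_def)
    also have "\<dots> = norm c * measure lborel (U - A)"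
      by simp
    also have "\<dots> \<le> norm c * d"
      using U(3) d(1) by (intro mult_left_mono) (auto simp: measure_def intro!: enn2real_leI)
    finally have "(LINT x|lborel. norm (indicator A x *\<^sub>R c - indicator U x *\<^sub>R c)) < e"
      using d by simp
    moreover have "integrable lborel (\<lambda>x. indicator U x *\<^sub>R c)"
      using U fin by auto
    ultimately show "\<exists>g. integrable lborel g \<and> L1_shift_continuous g \<and>
        (LINT x|lborel. norm (indicator A x *\<^sub>R c - g x)) < e"
      using L1_shift_continuous_open[OF U(1) fin, of c] by blast
  qed
next
  case (add f g)
  show ?case
    unfolding L1_shift_continuous_def
  proof (intro allI impI)
    fix u :: "nat \<Rightarrow> real" assume u: "u \<longlonglongrightarrow> 0"
    note sh = lborel_integrable_shift_iff[of _ "u _"]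
    have lim: "(\<lambda>n. (LINT x|lborel. norm (f (x - u n) - f x)) + (LINT x|lborel. norm (g (x - u n) - g x))) \<longlonglongrightarrow> 0 + 0"
      using add u by (intro tendsto_add) (auto simp: L1_shift_continuous_def)
    show "(\<lambda>n. LINT x|lborel. norm (f (x - u n) + g (x - u n) - (f x + g x))) \<longlonglongrightarrow> 0"
    proof (rule tendsto_sandwich[OF _ _ tendsto_const])
      show "\<forall>\<^sub>F n in sequentially. (LINT x|lborel. norm (f (x - u n) + g (x - u n) - (f x + g x)))
          \<le> (LINT x|lborel. norm (f (x - u n) - f x)) + (LINT x|lborel. norm (g (x - u n) - g x))"
      proof (intro always_eventually allI)
        fix n
        have "(LINT x|lborel. norm (f (x - u n) + g (x - u n) - (f x + g x))) \<le>
            (LINT x|lborel. norm (f (x - u n) - f x) + norm (g (x - u n) - g x))"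
          using add sh[of f n] sh[of g n]
          by (intro integral_mono) (auto simp: add_diff_add norm_triangle_ineq)
        then show "(LINT x|lborel. norm (f (x - u n) + g (x - u n) - (f x + g x)))
          \<le> (LINT x|lborel. norm (f (x - u n) - f x)) + (LINT x|lborel. norm (g (x - u n) - g x))"
          using add sh[of f n] sh[of g n] by simp
      qed
    qed (use lim in auto)
  qed
next
  case (lim f s)
  then have lim_bound: "norm (s i x) \<le> 2 * norm (f x)" for i x
    by simp
  show ?case
  proof (rule L1_shift_continuous_approx)
    show "integrable lborel f" by fact
    fix e :: real assume "e > 0"
    \<comment> \<open>The dominating function has the constant 3 = 1 + 2, since the simple functions
      are bounded by twice the norm of f.\<close>
    have "(\<lambda>i. LINT x|lborel. norm (f x - s i x)) \<longlonglongrightarrow> (LINT (x::real)|lborel. 0)"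
    proof (rule integral_dominated_convergence[where w = "\<lambda>x. 3 * norm (f x)"])
      show "AE x in lborel. (\<lambda>i. norm (f x - s i x)) \<longlonglongrightarrow> 0"
        using lim by (intro AE_I2) (auto intro!: tendsto_eq_intros)
      show "AE x in lborel. norm (norm (f x - s i x)) \<le> 3 * norm (f x)" for i
      proof (intro AE_I2)
        fix x
        show "norm (norm (f x - s i x)) \<le> 3 * norm (f x)"
          using lim_bound[of i x] norm_triangle_ineq4[of "f x" "s i x"] by simp
      qed
    qed (use lim in auto)
    then have "\<forall>\<^sub>F i in sequentially. (LINT x|lborel. norm (f x - s i x)) < e"
      using \<open>e > 0\<close> by (intro order_tendstoD(2)) auto
    then obtain i where "(LINT x|lborel. norm (f x - s i x)) < e"
      by (auto simp: eventually_sequentially)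
    with lim(1) lim.IH show "\<exists>g. integrable lborel g \<and> L1_shift_continuous g \<and> (LINT x|lborel. norm (f x - g x)) < e"
      by blast
  qed
qed

text \<open>For equal signs the difference of the signed squares has modulus |a - b| |a + b|, and |a
  - b| \<le> |a + b|. For opposite signs it has modulus a^2 + b^2, and the constant 2 is attained at
  a = -b.\<close>

lemma square_diff_le_signed_square:
  fixes a b :: real
  shows "(a - b)\<^sup>2 \<le> 2 * \<bar>a * \<bar>a\<bar> - b * \<bar>b\<bar>\<bar>"
proof -
  have *: "(a - b)\<^sup>2 \<le> 2 * \<bar>a * \<bar>a\<bar> - b * \<bar>b\<bar>\<bar>" if "b \<le> a" for a b :: real
  proof (cases "0 \<le> b")
    case True
    have "(a - b) * (a - b) \<le> (a - b) * (2 * (a + b))"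
      using that True by (intro mult_left_mono) auto
    also have "\<dots> = 2 * (a * a - b * b)"
      by (simp add: algebra_simps)
    also have "\<dots> \<le> 2 * \<bar>a * a - b * b\<bar>"
      by (intro mult_left_mono abs_ge_self) simp
    finally show ?thesis
      using that True by (simp add: power2_eq_square)
  next
    case b: False
    show ?thesis
    proof (cases "0 \<le> a")
      case True
      have "(a - b)\<^sup>2 \<le> 2 * (a * a + b * b)"
        using zero_le_power2[of "a + b"] by (simp add: power2_eq_square algebra_simps)
      then show ?thesis
        using True b by (simp add: abs_le_iff)
    next
      case False
      have "(a - b) * (a - b) \<le> (a - b) * (2 * (- a - b))"
        using that False b by (intro mult_left_mono) auto
      also have "\<dots> = 2 * (b * b - a * a)"
        by (simp add: algebra_simps)
      also have "\<dots> \<le> 2 * \<bar>b * b - a * a\<bar>"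
        by (intro mult_left_mono abs_ge_self) simp
      finally show ?thesis
        using False b by (simp add: power2_eq_square)
    qed
  qed
  show ?thesis
  proof (cases "b \<le> a")
    case False
    then show ?thesis using *[of a b]
      by (simp add: power2_commute[of a b] abs_minus_commute[of "a * \<bar>a\<bar>"])
  qed (rule *)
qed

lemma integrable_power2_Re_Im:
  fixes h :: "real \<Rightarrow> complex"
  assumes [measurable]: "h \<in> borel_measurable borel"
    and h: "integrable lborel (\<lambda>x. (cmod (h x))\<^sup>2)"
  shows "integrable lborel (\<lambda>x. Re (h x) * \<bar>Re (h x)\<bar>)" "integrable lborel (\<lambda>x. Im (h x) * \<bar>Im (h x)\<bar>)"
proof -
  have "\<bar>Re z * \<bar>Re z\<bar>\<bar> \<le> (cmod z)\<^sup>2" "\<bar>Im z * \<bar>Im z\<bar>\<bar> \<le> (cmod z)\<^sup>2" for z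
    unfolding cmod_power2 by (simp_all add: abs_mult power2_eq_square)
  then show "integrable lborel (\<lambda>x. Re (h x) * \<bar>Re (h x)\<bar>)" "integrable lborel (\<lambda>x. Im (h x) * \<bar>Im (h x)\<bar>)"
    by (auto intro!: Bochner_Integration.integrable_bound[OF h])
qed

text \<open>Bounding \<open>(a - b)\<^sup>2\<close> by the difference of the signed squares reduces the continuity of
  translations in \<open>L\<^sup>2\<close> to that in \<open>L\<^sup>1\<close>.\<close>

lemma L2_shift_continuous:
  fixes h :: "real \<Rightarrow> complex"
  assumes [measurable]: "h \<in> borel_measurable borel"
    and h: "integrable lborel (\<lambda>x. (cmod (h x))\<^sup>2)" and u: "u \<longlonglongrightarrow> 0"
  shows "(\<lambda>n. LINT x|lborel. (cmod (h (x - u n) - h x))\<^sup>2) \<longlonglongrightarrow> 0"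
proof (rule tendsto_sandwich[OF _ _ tendsto_const])
  define p q where "p = (\<lambda>x. Re (h x) * \<bar>Re (h x)\<bar>)" and "q = (\<lambda>x. Im (h x) * \<bar>Im (h x)\<bar>)"
  have pq: "integrable lborel p" "integrable lborel q"
    unfolding p_def q_def using integrable_power2_Re_Im[OF assms(1) h] by auto
  let ?P = "\<lambda>n. LINT x|lborel. norm (p (x - u n) - p x)"
  let ?Q = "\<lambda>n. LINT x|lborel. norm (q (x - u n) - q x)"
  have "?P \<longlonglongrightarrow> 0" "?Q \<longlonglongrightarrow> 0"
    using pq[THEN integrable_imp_L1_shift_continuous] u by (auto simp: L1_shift_continuous_def)
  then show "(\<lambda>n. 2 * ?P n + 2 * ?Q n) \<longlonglongrightarrow> 0"
    by (auto intro!: tendsto_eq_intros)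
  show "\<forall>\<^sub>F n in sequentially. (LINT x|lborel. (cmod (h (x - u n) - h x))\<^sup>2) \<le> 2 * ?P n + 2 * ?Q n"
  proof (intro always_eventually allI)
    fix n
    have i: "integrable lborel (\<lambda>x. norm (p (x - u n) - p x))" "integrable lborel (\<lambda>x. norm (q (x - u n) - q x))"
      using pq lborel_integrable_shift_iff[of p "u n"] lborel_integrable_shift_iff[of q "u n"] by auto
    have le: "(cmod (h (x - u n) - h x))\<^sup>2 \<le> 2 * norm (p (x - u n) - p x) + 2 * norm (q (x - u n) - q x)" for x
      using square_diff_le_signed_square[of "Re (h (x - u n))" "Re (h x)"]
        square_diff_le_signed_square[of "Im (h (x - u n))" "Im (h x)"]
      by (simp add: cmod_power2 p_def q_def)
    have "(LINT x|lborel. (cmod (h (x - u n) - h x))\<^sup>2) \<le>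
        (LINT x|lborel. 2 * norm (p (x - u n) - p x) + 2 * norm (q (x - u n) - q x))"
      using i le by (intro integral_mono') (auto intro!: add_nonneg_nonneg)
    then show "(LINT x|lborel. (cmod (h (x - u n) - h x))\<^sup>2) \<le> 2 * ?P n + 2 * ?Q n"
      using i by simp
  qed
qed (auto intro!: always_eventually)

section \<open>The Fourier transform\<close>

text \<open>Sign and normalisation are those of \<open>stft\<close>, so that an STFT with fixed x is
  this transform of a product. Integration over \<open>lborel\<close> keeps Fubini on the product
  measure within reach.\<close>

definition fourier :: "(real \<Rightarrow> complex) \<Rightarrow> real \<Rightarrow> complex" where
  "fourier h \<omega> = (LINT t|lborel. h t * cis (- 2 * pi * t * \<omega>))"

lemma borel_measurable_cis [measurable (raw)]:
  "f \<in> borel_measurable M \<Longrightarrow> (\<lambda>x. cis (f x)) \<in> borel_measurable M"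
  by (rule borel_measurable_continuous_on[OF continuous_on_cis[OF continuous_on_id]])

lemma borel_measurable_cnj [measurable (raw)]:
  "f \<in> borel_measurable M \<Longrightarrow> (\<lambda>x. cnj (f x)) \<in> borel_measurable M"
  by (rule borel_measurable_continuous_on[OF continuous_on_cnj[OF continuous_on_id]])

lemma borel_measurable_fourier [measurable]:
  assumes [measurable]: "h \<in> borel_measurable borel"
  shows "fourier h \<in> borel_measurable borel"
  unfolding fourier_def by measurable

lemma integrable_mult_cis:
  assumes "integrable lborel h" and [measurable]: "f \<in> borel_measurable borel"
  shows "integrable lborel (\<lambda>t. h t * cis (f t))"
proof -
  have [measurable]: "h \<in> borel_measurable borel"
    using assms(1) by auto
  show ?thesis
    by (rule Bochner_Integration.integrable_bound[OF assms(1)]) (auto simp: norm_mult)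
qed

lemma norm_fourier_le: "cmod (fourier h \<omega>) \<le> (LINT t|lborel. cmod (h t))"
proof -
  have "cmod (fourier h \<omega>) \<le> (LINT t|lborel. cmod (h t * cis (- 2 * pi * t * \<omega>)))"
    unfolding fourier_def by (rule integral_norm_bound)
  then show ?thesis by (simp add: norm_mult)
qed

lemma integrable_mult_bounded:
  fixes f g :: "real \<Rightarrow> complex"
  assumes "integrable lborel f" and [measurable]: "g \<in> borel_measurable borel"
    and "\<And>x. cmod (g x) \<le> c"
  shows "integrable lborel (\<lambda>x. f x * g x)"
proof -
  have [measurable]: "f \<in> borel_measurable borel"
    using assms(1) by auto
  show ?thesis
  proof (rule Bochner_Integration.integrable_bound)
    show "integrable lborel (\<lambda>x. of_real c * f x)"
      using assms by simp
    have "cmod (f x) * cmod (g x) \<le> cmod (f x) * \<bar>c\<bar>" for x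
      using assms(3)[of x] by (intro mult_left_mono) auto
    then show "AE x in lborel. cmod (f x * g x) \<le> cmod (of_real c * f x)"
      by (auto simp: norm_mult mult.commute)
  qed auto
qed

text \<open>Fubini applies because the kernel has modulus 1, and the kernel is symmetric in t and
  \<omega>. Moving the hat from one factor to the other is the substitute for Fourier inversion
  throughout.\<close>

lemma fourier_multiplication_formula:
  assumes a: "integrable lborel a" and b: "integrable lborel b"
  shows "(LINT \<omega>|lborel. fourier a \<omega> * b \<omega>) = (LINT t|lborel. a t * fourier b t)"
proof -
  have [measurable]: "a \<in> borel_measurable borel" "b \<in> borel_measurable borel"
    using a b by auto
  let ?f = "\<lambda>t \<omega>. a t * b \<omega> * cis (- 2 * pi * t * \<omega>)"
  have "integrable (lborel \<Otimes>\<^sub>M lborel) (case_prod ?f)"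
  proof (rule lborel_pair.Fubini_integrable)
    show "AE x in lborel. integrable lborel (\<lambda>y. case_prod ?f (x, y))"
      using b by (intro AE_I2) (auto intro!: integrable_mult_cis)
  qed (use a in \<open>auto simp: norm_mult split_beta'\<close>)
  then have "(LINT \<omega>|lborel. LINT t|lborel. ?f t \<omega>) = (LINT t|lborel. LINT \<omega>|lborel. ?f t \<omega>)"
    by (rule lborel_pair.Fubini_integral)
  moreover have "(LINT t|lborel. ?f t \<omega>) = fourier a \<omega> * b \<omega>" for \<omega>
    unfolding fourier_def by (subst integral_mult_left_zero[symmetric]) (simp add: mult_ac)
  moreover have "(LINT \<omega>|lborel. ?f t \<omega>) = a t * fourier b t" for t
    unfolding fourier_def by (subst integral_mult_right_zero[symmetric]) (simp add: mult_ac)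
  ultimately show ?thesis by simp
qed

text \<open>Conjugation and reflection each reverse the sign of the phase, so together they leave
  the conjugate of the transform, and the translation contributes the factor \<open>cis\<close>.
  That factor is itself a Fourier kernel in t, which is how it gets absorbed in later
  integrals.\<close>

lemma fourier_reflect_cnj:
  "fourier (\<lambda>s. cnj (h (t - s))) \<omega> = cis (- 2 * pi * \<omega> * t) * cnj (fourier h \<omega>)"
proof -
  have "fourier (\<lambda>s. cnj (h (t - s))) \<omega> = (LINT s|lborel. cnj (h (t - (t - s))) * cis (- 2 * pi * (t - s) * \<omega>))"
    unfolding fourier_def by (rule lborel_integral_reflect[symmetric])
  also have "\<dots> = (LINT s|lborel. cis (- 2 * pi * \<omega> * t) * cnj (h s * cis (- 2 * pi * s * \<omega>)))"
    by (intro Bochner_Integration.integral_cong refl) (simp add: cis_mult cis_cnj algebra_simps)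
  also have "\<dots> = cis (- 2 * pi * \<omega> * t) * cnj (fourier h \<omega>)"
    unfolding fourier_def by (simp only: integral_mult_right_zero Bochner_Integration.integral_cnj)
  finally show ?thesis .
qed

text \<open>The characteristic function of the standard normal distribution, evaluated at - n u
  after the substitution \<omega> = n x / (2 pi). The scale is chosen so that the transform is the
  normal density of standard deviation 1/n, an approximate identity as n grows.\<close>

lemma fourier_gaussian:
  assumes "n > 0"
  shows "fourier (\<lambda>\<omega>. of_real (exp (- (2 * pi * \<omega> / n)\<^sup>2 / 2))) u = of_real (n * std_normal_density (n * u))"
proof -
  have "of_real (exp (- (n * u)\<^sup>2 / 2)) = char std_normal_distribution (- n * u)"
    by (simp add: char_std_normal_distribution power_mult_distrib)
  also have "\<dots> = (LINT x|lborel. std_normal_density x *\<^sub>R cis (- n * u * x))"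
    unfolding char_def by (subst integral_density) (auto simp: cis_conv_exp)
  also have "\<dots> = (LINT x|lborel. of_real (1 / sqrt (2 * pi)) * (of_real (exp (- x\<^sup>2 / 2)) * cis (- n * u * x)))"
    by (simp add: std_normal_density_def scaleR_conv_of_real mult_ac)
  also have "\<dots> = of_real (1 / sqrt (2 * pi)) * (LINT x|lborel. (of_real (exp (- x\<^sup>2 / 2)) * cis (- n * u * x)))"
    by simp
  finally have 1: "(LINT x|lborel. (of_real (exp (- x\<^sup>2 / 2)) * cis (- n * u * x))) =
      of_real (sqrt (2 * pi) * exp (- (n * u)\<^sup>2 / 2))"
    by (simp add: field_simps)
  have "fourier (\<lambda>\<omega>. of_real (exp (- (2 * pi * \<omega> / n)\<^sup>2 / 2))) u =
    \<bar>n / (2 * pi)\<bar> *\<^sub>R (LINT x|lborel. of_real (exp (- (2 * pi * (0 + n / (2 * pi) * x) / n)\<^sup>2 / 2)) * cis (- 2 * pi * (0 + n / (2 * pi) * x) * u))"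
    unfolding fourier_def using assms by (intro lborel_integral_real_affine) auto
  also have "(LINT x|lborel. of_real (exp (- (2 * pi * (0 + n / (2 * pi) * x) / n)\<^sup>2 / 2)) * cis (- 2 * pi * (0 + n / (2 * pi) * x) * u))
     = (LINT x|lborel. (of_real (exp (- x\<^sup>2 / 2)) * cis (- n * u * x)))"
    using assms by (intro Bochner_Integration.integral_cong refl) (simp add: mult_ac)
  also note 1
  also have "\<bar>n / (2 * pi)\<bar> *\<^sub>R complex_of_real (sqrt (2 * pi) * exp (- (n * u)\<^sup>2 / 2)) =
      of_real (n / (2 * pi) * sqrt (2 * pi) * exp (- (n * u)\<^sup>2 / 2))"
    using assms by (simp add: scaleR_conv_of_real mult_ac)
  also have "n / (2 * pi) * sqrt (2 * pi) * exp (- (n * u)\<^sup>2 / 2) = n * std_normal_density (n * u)"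
    unfolding std_normal_density_def
    using real_sqrt_mult_self[of "2 * pi"] by (simp add: field_simps)
  finally show ?thesis .
qed

section \<open>Plancherel's formula\<close>

lemma integrable_gaussian_weight:
  assumes "n > 0"
  shows "integrable lborel (\<lambda>\<omega>. exp (- (2 * pi * \<omega> / n)\<^sup>2 / 2))"
proof -
  have "integrable lborel std_normal_density"
    by (rule integrable_normal_density) simp
  then have "integrable lborel (\<lambda>\<omega>. sqrt (2 * pi) * std_normal_density (0 + 2 * pi / n * \<omega>))"
    using assms by (intro integrable_mult_right lborel_integrable_real_affine) auto
  also have "(\<lambda>\<omega>. sqrt (2 * pi) * std_normal_density (0 + 2 * pi / n * \<omega>)) = (\<lambda>\<omega>. exp (- (2 * pi * \<omega> / n)\<^sup>2 / 2))"
    by (simp add: std_normal_density_def mult_ac)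
  finally show ?thesis .
qed

lemma std_normal_density_le_1: "std_normal_density x \<le> 1"
proof -
  have "exp (- x\<^sup>2 / 2) \<le> 1"
    by simp
  also have "1 \<le> sqrt (2 * pi)"
    using pi_gt3 by simp
  finally show ?thesis
    by (simp add: std_normal_density_def)
qed

lemma cmod_diff_power2:
  "(cmod (z - w))\<^sup>2 = (cmod z)\<^sup>2 + (cmod w)\<^sup>2 - 2 * Re (w * cnj z)"
  by (simp add: cmod_power2) (simp add: power2_eq_square algebra_simps)

lemma cmod_diff_power2_le: "(cmod (z - w))\<^sup>2 \<le> 2 * (cmod z)\<^sup>2 + 2 * (cmod w)\<^sup>2"
proof -
  have "(cmod (z - w))\<^sup>2 + (cmod (z + w))\<^sup>2 = 2 * (cmod z)\<^sup>2 + 2 * (cmod w)\<^sup>2"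
    by (simp add: cmod_power2) (simp add: power2_eq_square algebra_simps)
  then show ?thesis
    using zero_le_power2[of "cmod (z + w)"] by linarith
qed

lemma integrable_power2_diff:
  fixes f g :: "real \<Rightarrow> complex"
  assumes [measurable]: "f \<in> borel_measurable borel" "g \<in> borel_measurable borel"
    and "integrable lborel (\<lambda>x. (cmod (f x))\<^sup>2)" "integrable lborel (\<lambda>x. (cmod (g x))\<^sup>2)"
  shows "integrable lborel (\<lambda>x. (cmod (f x - g x))\<^sup>2)"
proof (rule Bochner_Integration.integrable_bound)
  show "integrable lborel (\<lambda>x. 2 * (cmod (f x))\<^sup>2 + 2 * (cmod (g x))\<^sup>2)"
    using assms by auto
qed (auto intro!: order_trans[OF cmod_diff_power2_le])

lemma integrable_mult_L2:
  fixes f g :: "real \<Rightarrow> complex"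
  assumes [measurable]: "f \<in> borel_measurable borel" "g \<in> borel_measurable borel"
    and "integrable lborel (\<lambda>x. (cmod (f x))\<^sup>2)" "integrable lborel (\<lambda>x. (cmod (g x))\<^sup>2)"
  shows "integrable lborel (\<lambda>x. f x * g x)"
proof (rule Bochner_Integration.integrable_bound)
  show "integrable lborel (\<lambda>x. (cmod (f x))\<^sup>2 + (cmod (g x))\<^sup>2)"
    using assms by auto
  have "a * b \<le> a\<^sup>2 + b\<^sup>2" if "0 \<le> a" "0 \<le> b" for a b :: real
    using sum_squares_bound[of a b] mult_nonneg_nonneg[OF that] by linarith
  then show "AE x in lborel. norm (f x * g x) \<le> norm ((cmod (f x))\<^sup>2 + (cmod (g x))\<^sup>2)"
    by (auto simp: norm_mult)
qed auto

text \<open>With w the Gaussian weight, |h^|^2 w is split as h^ times (w \<open>cnj\<close> h^) and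
  the hat is moved off the first factor. What appears is the autocorrelation of h averaged against
  the transform of w, and polarisation expresses its real part by the L^2 distance of h from its
  translates.\<close>

lemma gaussian_plancherel:
  assumes h: "integrable lborel h" and h2: "integrable lborel (\<lambda>x. (cmod (h x))\<^sup>2)" and n: "n > 0"
  defines "N \<equiv> LINT x|lborel. (cmod (h x))\<^sup>2"
  shows "(LINT \<omega>|lborel. (cmod (fourier h \<omega>))\<^sup>2 * exp (- (2 * pi * \<omega> / n)\<^sup>2 / 2)) =
    (LINT v|lborel. std_normal_density v * (N - (LINT x|lborel. (cmod (h (x - v / n) - h x))\<^sup>2) / 2))"
proof -
  have [measurable]: "h \<in> borel_measurable borel"
    using h by auto
  define w where "w = (\<lambda>\<omega>. complex_of_real (exp (- (2 * pi * \<omega> / n)\<^sup>2 / 2)))"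
  define K where "K = (\<lambda>u. n * std_normal_density (n * u))"
  have [measurable]: "K \<in> borel_measurable borel" "w \<in> borel_measurable borel"
    by (auto simp: K_def w_def)
  have w: "integrable lborel w"
    using integrable_gaussian_weight[OF n] by (simp add: w_def)
  have fw: "fourier w u = of_real (K u)" for u
    unfolding w_def K_def by (rule fourier_gaussian[OF n])
  have fhw: "integrable lborel (\<lambda>\<omega>. w \<omega> * cnj (fourier h \<omega>))"
    by (rule integrable_mult_bounded[OF w, where c = "LINT t|lborel. cmod (h t)"])
      (measurable, simp add: norm_fourier_le)
  \<comment> \<open>The kernel of the outer transform is exactly the phase that
    \<open>fourier_reflect_cnj\<close> produces for the reflected translate, so the multiplication
    formula moves the hat onto w.\<close>
  have S2: "fourier (\<lambda>\<omega>. w \<omega> * cnj (fourier h \<omega>)) t = (LINT u|lborel. cnj (h (t - u)) * of_real (K u))" for t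
  proof -
    have "fourier (\<lambda>\<omega>. w \<omega> * cnj (fourier h \<omega>)) t = (LINT \<omega>|lborel. fourier (\<lambda>s. cnj (h (t - s))) \<omega> * w \<omega>)"
      unfolding fourier_reflect_cnj unfolding fourier_def[of "\<lambda>\<omega>. w \<omega> * cnj (fourier h \<omega>)"] by (simp add: mult_ac)
    also have "\<dots> = (LINT u|lborel. cnj (h (t - u)) * fourier w u)"
      using h w lborel_integrable_reflect_iff[of "\<lambda>s. cnj (h s)" t]
      by (intro fourier_multiplication_formula) auto
    finally show ?thesis by (simp add: fw)
  qed
  let ?f = "\<lambda>t u. h t * cnj (h (t - u)) * of_real (K u)"
  \<comment> \<open>The standard normal density is at most 1, so K is at most n; what remains is a
    product of h with a reflected translate, integrable in the plane because h is in L^1.\<close>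
  have int: "integrable (lborel \<Otimes>\<^sub>M lborel) (case_prod ?f)"
  proof (rule Bochner_Integration.integrable_bound)
    have "integrable (lborel \<Otimes>\<^sub>M lborel) (\<lambda>(t, u). h t * cnj (h (t - u)))"
    proof (rule lborel_pair.Fubini_integrable)
      show "AE t in lborel. integrable lborel (\<lambda>y. case (t, y) of (t, u) \<Rightarrow> h t * cnj (h (t - u)))"
        using h lborel_integrable_reflect_iff[of "\<lambda>s. cnj (h s)"] by (intro AE_I2) auto
    qed (use h in \<open>auto simp: norm_mult split_beta' lborel_integral_reflect[of "\<lambda>x. cmod (h x)"]\<close>)
    then show "integrable (lborel \<Otimes>\<^sub>M lborel) (\<lambda>p. of_real n * (case p of (t, u) \<Rightarrow> h t * cnj (h (t - u))))"
      by (rule integrable_mult_right)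
    have "norm (z * of_real (K u)) \<le> norm (of_real n * z)" for z :: complex and u
      unfolding K_def using n std_normal_density_le_1[of "n * u"]
      by (simp add: norm_mult mult_left_le mult_ac mult_left_mono)
    then show "AE p in lborel \<Otimes>\<^sub>M lborel. norm (case_prod ?f p) \<le> norm (of_real n * (case p of (t, u) \<Rightarrow> h t * cnj (h (t - u))))"
      by (intro AE_I2) (auto split: prod.split)
  qed measurable
  \<comment> \<open>Polarisation: the squared distance is 2 N minus twice the real part of the
    autocorrelation, because the translate has the same norm.\<close>
  have S3: "Re (LINT t|lborel. h t * cnj (h (t - u))) = N - (LINT x|lborel. (cmod (h (x - u) - h x))\<^sup>2) / 2" for u
  proof -
    have hu2: "integrable lborel (\<lambda>x. (cmod (h (x - u)))\<^sup>2)"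
      using h2 lborel_integrable_shift_iff[of "\<lambda>x. (cmod (h x))\<^sup>2" u] by simp
    then have i: "integrable lborel (\<lambda>t. h t * cnj (h (t - u)))"
      using h2 by (intro integrable_mult_L2) auto
    have "(LINT x|lborel. (cmod (h (x - u) - h x))\<^sup>2) =
        (LINT x|lborel. (cmod (h (x - u)))\<^sup>2) + N - 2 * (LINT t|lborel. Re (h t * cnj (h (t - u))))"
      unfolding cmod_diff_power2 N_def using h2 hu2 i by (simp del: times_complex.sel)
    also have "(LINT x|lborel. (cmod (h (x - u)))\<^sup>2) = N"
      unfolding N_def by (rule lborel_integral_shift)
    finally show ?thesis
      unfolding integral_Re[OF i] by linarith
  qed
  define D where "D = (\<lambda>u. LINT x|lborel. (cmod (h (x - u) - h x))\<^sup>2)"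
  have "complex_of_real (LINT \<omega>|lborel. (cmod (fourier h \<omega>))\<^sup>2 * exp (- (2 * pi * \<omega> / n)\<^sup>2 / 2)) =
      (LINT \<omega>|lborel. fourier h \<omega> * (w \<omega> * cnj (fourier h \<omega>)))"
    unfolding w_def by (subst integral_complex_of_real[symmetric])
      (simp add: complex_norm_square mult_ac flip: of_real_power)
  also have "\<dots> = (LINT t|lborel. LINT u|lborel. ?f t u)"
    unfolding fourier_multiplication_formula[OF h fhw] S2
    by (subst integral_mult_right_zero[symmetric]) (simp add: mult_ac)
  also have "\<dots> = (LINT u|lborel. LINT t|lborel. ?f t u)"
    by (rule lborel_pair.Fubini_integral[OF int, symmetric])
  finally have eq: "complex_of_real (LINT \<omega>|lborel. (cmod (fourier h \<omega>))\<^sup>2 * exp (- (2 * pi * \<omega> / n)\<^sup>2 / 2)) =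
      (LINT u|lborel. LINT t|lborel. ?f t u)" .
  have "(LINT \<omega>|lborel. (cmod (fourier h \<omega>))\<^sup>2 * exp (- (2 * pi * \<omega> / n)\<^sup>2 / 2)) =
      Re (LINT u|lborel. LINT t|lborel. ?f t u)"
    unfolding eq[symmetric] by (rule Re_complex_of_real[symmetric])
  also have "\<dots> = (LINT u|lborel. Re (LINT t|lborel. ?f t u))"
    by (rule integral_Re[symmetric, OF lborel_pair.integrable_snd[OF int]])
  also have "\<dots> = (LINT u|lborel. K u * (N - D u / 2))"
  proof (intro Bochner_Integration.integral_cong refl)
    fix u
    have "(LINT t|lborel. ?f t u) = (LINT t|lborel. h t * cnj (h (t - u))) * of_real (K u)"
      by (rule integral_mult_left_zero)
    then have "Re (LINT t|lborel. ?f t u) = Re (LINT t|lborel. h t * cnj (h (t - u))) * K u"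
      by (simp only:) simp
    then show "Re (LINT t|lborel. ?f t u) = K u * (N - D u / 2)"
      unfolding S3 D_def by (simp only: mult.commute)
  qed
  \<comment> \<open>Substituting u = v / n moves n out of the density and into the shift, so that a
    limit in n acts on D alone under a fixed weight.\<close>
  also have "\<dots> = \<bar>1 / n\<bar> *\<^sub>R (LINT v|lborel. K (0 + 1 / n * v) * (N - D (0 + 1 / n * v) / 2))"
    using n by (intro lborel_integral_real_affine) auto
  also have "\<dots> = (LINT v|lborel. std_normal_density v * (N - D (v / n) / 2))"
    unfolding K_def using n by (simp add: mult.assoc)
  finally show ?thesis by (simp add: D_def)
qed

text \<open>As n grows the damped integrands increase to |h^|^2, so monotone convergence yields
  integrability of the limit together with its integral. The limit itself is computed on the
  Gaussian average by dominated convergence.\<close>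

theorem plancherel:
  assumes h: "integrable lborel h" and h2: "integrable lborel (\<lambda>x. (cmod (h x))\<^sup>2)"
  shows "integrable lborel (\<lambda>\<omega>. (cmod (fourier h \<omega>))\<^sup>2)"
    and "(LINT \<omega>|lborel. (cmod (fourier h \<omega>))\<^sup>2) = (LINT x|lborel. (cmod (h x))\<^sup>2)"
proof -
  have [measurable]: "h \<in> borel_measurable borel"
    using h by auto
  define N where "N = (LINT x|lborel. (cmod (h x))\<^sup>2)"
  define D where "D = (\<lambda>u. LINT x|lborel. (cmod (h (x - u) - h x))\<^sup>2)"
  have [measurable]: "D \<in> borel_measurable borel"
    unfolding D_def by measurable
  \<comment> \<open>The damping parameter is \<open>Suc i\<close> because it has to be
    positive.\<close>
  define g where "g = (\<lambda>(i::nat) \<omega>. (cmod (fourier h \<omega>))\<^sup>2 * exp (- (2 * pi * \<omega> / real (Suc i))\<^sup>2 / 2))"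
  \<comment> \<open>These two bounds amount to |N - D u / 2| \<le> N, the domination needed for the
    average.\<close>
  have D: "0 \<le> D u" "D u \<le> 4 * N" for u
  proof -
    show "0 \<le> D u" by (simp add: D_def)
    have hu2: "integrable lborel (\<lambda>x. (cmod (h (x - u)))\<^sup>2)"
      using h2 lborel_integrable_shift_iff[of "\<lambda>x. (cmod (h x))\<^sup>2" u] by simp
    have "D u \<le> (LINT x|lborel. 2 * (cmod (h (x - u)))\<^sup>2 + 2 * (cmod (h x))\<^sup>2)"
      unfolding D_def using h2 hu2 by (intro integral_mono cmod_diff_power2_le integrable_power2_diff) auto
    also have "\<dots> = 2 * (LINT x|lborel. (cmod (h (x - u)))\<^sup>2) + 2 * N"
      using h2 hu2 by (simp add: N_def)
    also have "(LINT x|lborel. (cmod (h (x - u)))\<^sup>2) = N"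
      unfolding N_def by (rule lborel_integral_shift)
    finally show "D u \<le> 4 * N" by simp
  qed
  have nd: "integrable lborel std_normal_density" "(LINT v|lborel. std_normal_density v) = 1"
    by (simp_all add: integrable_normal_density integral_normal_density)
  have "(\<lambda>i. LINT v|lborel. std_normal_density v * (N - D (v / real (Suc i)) / 2)) \<longlonglongrightarrow>
      (LINT v|lborel. std_normal_density v * (N - 0 / 2))"
  proof (rule integral_dominated_convergence[where w = "\<lambda>v. std_normal_density v * N"])
    show "AE v in lborel. (\<lambda>i. std_normal_density v * (N - D (v / real (Suc i)) / 2))
        \<longlonglongrightarrow> std_normal_density v * (N - 0 / 2)"
    proof (intro AE_I2 tendsto_intros)
      fix v :: real
      have "(\<lambda>i. v / real (Suc i)) \<longlonglongrightarrow> 0"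
        by real_asymp
      then show "(\<lambda>i. D (v / real (Suc i))) \<longlonglongrightarrow> 0"
        unfolding D_def using h2 by (intro L2_shift_continuous) auto
    qed simp
    show "AE v in lborel. norm (std_normal_density v * (N - D (v / real (Suc i)) / 2)) \<le> std_normal_density v * N" for i
    proof (intro AE_I2)
      fix v :: real
      have "\<bar>N - D (v / real (Suc i)) / 2\<bar> \<le> N"
        using D[of "v / real (Suc i)"] by linarith
      then show "norm (std_normal_density v * (N - D (v / real (Suc i)) / 2)) \<le> std_normal_density v * N"
        by (simp add: abs_mult mult_left_mono)
    qed
  qed (use nd in auto)
  moreover have "(LINT \<omega>|lborel. g i \<omega>) = (LINT v|lborel. std_normal_density v * (N - D (v / real (Suc i)) / 2))" for i
    unfolding g_def N_def D_def by (rule gaussian_plancherel[OF h h2]) simp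
  ultimately have lim: "(\<lambda>i. LINT \<omega>|lborel. g i \<omega>) \<longlonglongrightarrow> N"
    using nd by simp
  have gi: "integrable lborel (g i)" for i
  proof -
    have "integrable lborel (\<lambda>\<omega>. complex_of_real (exp (- (2 * pi * \<omega> / real (Suc i))\<^sup>2 / 2)) * of_real ((cmod (fourier h \<omega>))\<^sup>2))"
      using integrable_gaussian_weight[of "real (Suc i)"]
      by (intro integrable_mult_bounded[where c = "(LINT t|lborel. cmod (h t))\<^sup>2"])
        (auto simp: norm_power intro!: power_mono norm_fourier_le)
    then have "integrable lborel (\<lambda>\<omega>. Re (complex_of_real (exp (- (2 * pi * \<omega> / real (Suc i))\<^sup>2 / 2)) * of_real ((cmod (fourier h \<omega>))\<^sup>2)))"
      by (rule integrable_Re)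
    then show ?thesis
      by (simp add: g_def mult.commute del: of_real_exp of_real_power)
  qed
  have mono: "AE \<omega> in lborel. mono (\<lambda>i. g i \<omega>)"
  proof (intro AE_I2 monoI)
    fix \<omega> :: real and i j :: nat assume "i \<le> j"
    then have "\<bar>2 * pi * \<omega> / real (Suc j)\<bar> \<le> \<bar>2 * pi * \<omega> / real (Suc i)\<bar>"
      by (simp add: abs_divide divide_left_mono)
    then have "(2 * pi * \<omega> / real (Suc j))\<^sup>2 \<le> (2 * pi * \<omega> / real (Suc i))\<^sup>2"
      by (rule abs_le_square_iff[THEN iffD1])
    then show "g i \<omega> \<le> g j \<omega>"
      unfolding g_def by (intro mult_left_mono) auto
  qed
  have ptw: "AE \<omega> in lborel. (\<lambda>i. g i \<omega>) \<longlonglongrightarrow> (cmod (fourier h \<omega>))\<^sup>2"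
  proof (intro AE_I2)
    fix \<omega> :: real
    have "(\<lambda>i. 2 * pi * \<omega> / real (Suc i)) \<longlonglongrightarrow> 0"
      by real_asymp
    then have "(\<lambda>i. exp (- (2 * pi * \<omega> / real (Suc i))\<^sup>2 / 2)) \<longlonglongrightarrow> exp (- 0\<^sup>2 / 2)"
      by (intro tendsto_exp tendsto_divide tendsto_minus tendsto_power tendsto_const) auto
    then show "(\<lambda>i. g i \<omega>) \<longlonglongrightarrow> (cmod (fourier h \<omega>))\<^sup>2"
      unfolding g_def using tendsto_mult_left[of _ 1 sequentially "(cmod (fourier h \<omega>))\<^sup>2"] by simp
  qed
  show "integrable lborel (\<lambda>\<omega>. (cmod (fourier h \<omega>))\<^sup>2)"
    using gi mono ptw lim by (rule integrable_monotone_convergence) measurable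
  show "(LINT \<omega>|lborel. (cmod (fourier h \<omega>))\<^sup>2) = (LINT x|lborel. (cmod (h x))\<^sup>2)"
    using gi mono ptw lim unfolding N_def by (rule integral_monotone_convergence) measurable
qed

section \<open>Correlations and pairings with band-limited functions\<close>

text \<open>A form of the convolution theorem: the inner integral over x gives \<open>cnj\<close> of
  p^ times a phase in t, and this phase is the kernel of the transform of d.\<close>

lemma fourier_correlation:
  assumes d: "integrable lborel d" and p: "integrable lborel p"
  shows "fourier (\<lambda>x. LINT t|lborel. d t * cnj (p (t - x))) \<eta> = fourier d \<eta> * cnj (fourier p \<eta>)"
proof -
  have [measurable]: "d \<in> borel_measurable borel" "p \<in> borel_measurable borel"
    using d p by auto
  let ?f = "\<lambda>t x. d t * cnj (p (t - x)) * cis (- 2 * pi * x * \<eta>)"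
  have "integrable (lborel \<Otimes>\<^sub>M lborel) (case_prod ?f)"
  proof (rule lborel_pair.Fubini_integrable)
    show "AE t in lborel. integrable lborel (\<lambda>x. case_prod ?f (t, x))"
      using p lborel_integrable_reflect_iff[of "\<lambda>s. cnj (p s)"] by (intro AE_I2) (auto intro!: integrable_mult_cis)
  qed (use d in \<open>auto simp: norm_mult split_beta' lborel_integral_reflect[of "\<lambda>x. cmod (p x)"]\<close>)
  then have swap: "(LINT x|lborel. LINT t|lborel. ?f t x) = (LINT t|lborel. LINT x|lborel. ?f t x)"
    by (rule lborel_pair.Fubini_integral)
  have "fourier (\<lambda>x. LINT t|lborel. d t * cnj (p (t - x))) \<eta> = (LINT x|lborel. LINT t|lborel. ?f t x)"
    unfolding fourier_def integral_mult_left_zero ..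
  also note swap
  also have "(LINT t|lborel. LINT x|lborel. ?f t x) = (LINT t|lborel. d t * fourier (\<lambda>x. cnj (p (t - x))) \<eta>)"
    unfolding fourier_def mult.assoc integral_mult_right_zero ..
  also have "\<dots> = (LINT t|lborel. (d t * cis (- 2 * pi * t * \<eta>)) * cnj (fourier p \<eta>))"
    unfolding fourier_reflect_cnj by (simp only: mult_ac)
  also have "\<dots> = fourier d \<eta> * cnj (fourier p \<eta>)"
    unfolding fourier_def[of d] integral_mult_left_zero ..
  finally show ?thesis .
qed

text \<open>Each factor \<open>fourier H\<close> is removed by one use of the multiplication
  formula, which leads to H(\<xi>) H(\<eta>) d^(\<xi> + \<eta>) without forming the convolution of H
  with itself. On the support of H in both variables, \<xi> + \<eta> lies in [-2B, 2B].\<close>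

lemma integral_mult_band_limited_eq_0:
  assumes d: "integrable lborel d" and H: "integrable lborel H"
    and supp: "\<And>\<xi>. \<xi> \<notin> {-B..B} \<Longrightarrow> H \<xi> = 0"
    and zero: "AE \<eta> in lborel. \<eta> \<in> {-2*B<..<2*B} \<longrightarrow> fourier d \<eta> = 0"
  shows "(LINT t|lborel. d t * (fourier H t * fourier H t)) = 0"
proof -
  have [measurable]: "d \<in> borel_measurable borel" "H \<in> borel_measurable borel"
    using d H by auto
  have dH: "integrable lborel (\<lambda>t. d t * fourier H t)"
    by (rule integrable_mult_bounded[OF d _ norm_fourier_le]) measurable
  have "H \<xi> * fourier (\<lambda>t. d t * fourier H t) \<xi> = 0" for \<xi>
  proof (cases "\<xi> \<in> {-B..B}")
    case True
    have "fourier (\<lambda>t. d t * fourier H t) \<xi> = (LINT t|lborel. fourier H t * (d t * cis (- 2 * pi * t * \<xi>)))"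
      unfolding fourier_def[of "\<lambda>t. d t * fourier H t"] by (simp add: mult_ac)
    also have "\<dots> = (LINT \<eta>|lborel. H \<eta> * fourier (\<lambda>t. d t * cis (- 2 * pi * t * \<xi>)) \<eta>)"
      using H d by (intro fourier_multiplication_formula integrable_mult_cis) auto
    \<comment> \<open>Modulation by \<xi> shifts the transform. The argument is written with
      \<open>1 * \<eta>\<close> to match the affine form in \<open>AE_borel_affine\<close>.\<close>
    also have "\<dots> = (LINT \<eta>|lborel. H \<eta> * fourier d (\<xi> + 1 * \<eta>))"
    proof (intro Bochner_Integration.integral_cong refl arg_cong2[where f = "(*)"])
      fix \<eta>
      have "cis (- 2 * pi * t * \<xi>) * cis (- 2 * pi * t * \<eta>) = cis (- 2 * pi * t * (\<xi> + 1 * \<eta>))" for t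
        unfolding cis_mult by (simp add: algebra_simps)
      then show "fourier (\<lambda>t. d t * cis (- 2 * pi * t * \<xi>)) \<eta> = fourier d (\<xi> + 1 * \<eta>)"
        unfolding fourier_def mult.assoc[of "d _"] by (simp only:)
    qed
    also have "\<dots> = 0"
    proof (rule integral_eq_zero_AE)
      have "AE \<eta> in lborel. \<xi> + 1 * \<eta> \<in> {-2*B<..<2*B} \<longrightarrow> fourier d (\<xi> + 1 * \<eta>) = 0"
        using zero by (intro AE_borel_affine[where P = "\<lambda>\<eta>. \<eta> \<in> {-2*B<..<2*B} \<longrightarrow> fourier d \<eta> = 0"]) auto
      \<comment> \<open>The vanishing of d^ is known on the open interval only; for fixed \<xi> the
        endpoints are reached at just two values of \<eta>, which are discarded.\<close>
      with AE_lborel_singleton[of "2 * B - \<xi>"] AE_lborel_singleton[of "- 2 * B - \<xi>"]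
      show "AE \<eta> in lborel. H \<eta> * fourier d (\<xi> + 1 * \<eta>) = 0"
      proof eventually_elim
        case (elim \<eta>)
        show ?case
        proof (cases "\<eta> \<in> {-B..B}")
          case eta: True
          have "\<xi> + 1 * \<eta> \<noteq> 2 * B" "\<xi> + 1 * \<eta> \<noteq> - 2 * B"
            using elim(1,2) by auto
          with True eta have "\<xi> + 1 * \<eta> \<in> {-2*B<..<2*B}"
            by (auto simp: less_le)
          then have "fourier d (\<xi> + 1 * \<eta>) = 0"
            using elim(3) by blast
          then show ?thesis
            by (simp only: mult_zero_right)
        qed (simp add: supp)
      qed
    qed
    finally show ?thesis by simp
  qed (simp add: supp)
  then have "(LINT \<xi>|lborel. H \<xi> * fourier (\<lambda>t. d t * fourier H t) \<xi>) = 0"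
    by (simp only: integral_zero)
  then show ?thesis
    using fourier_multiplication_formula[OF H dH] by (simp add: mult_ac)
qed

section \<open>Paley--Wiener functions\<close>

lemma lebesgue_ex_borel_measurable:
  fixes G :: "real \<Rightarrow> complex"
  assumes G: "G \<in> borel_measurable lebesgue"
  obtains G' where "G' \<in> borel_measurable borel" "AE x in lborel. G x = G' x"
proof -
  have "(\<lambda>x. Re (G x)) \<in> borel_measurable lebesgue" "(\<lambda>x. Im (G x)) \<in> borel_measurable lebesgue"
    using G by measurable
  note this[THEN completion_ex_borel_measurable_real]
  then obtain r i where [measurable]: "r \<in> borel_measurable lborel" "i \<in> borel_measurable lborel"
      and AE: "AE x in lborel. Re (G x) = r x" "AE x in lborel. Im (G x) = i x"
    by blast
  show ?thesis
  proof
    show "(\<lambda>x. of_real (r x) + \<i> * of_real (i x)) \<in> borel_measurable borel"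
      by measurable
    show "AE x in lborel. G x = of_real (r x) + \<i> * of_real (i x)"
      using AE by eventually_elim (simp add: complex_eq_iff)
  qed
qed

lemma L2_on_ex_borel_measurable:
  assumes F: "L2_on S F" and [measurable]: "S \<in> sets borel"
  obtains F' where "F' \<in> borel_measurable borel" "AE x in lborel. indicator S x *\<^sub>R F x = F' x"
    "integrable lborel (\<lambda>x. (cmod (F' x))\<^sup>2)" "\<And>x. x \<notin> S \<Longrightarrow> F' x = 0"
proof -
  obtain G where [measurable]: "G \<in> borel_measurable borel" and G: "AE x in lborel. indicator S x *\<^sub>R F x = G x"
    using F lebesgue_ex_borel_measurable unfolding L2_on_def by metis
  \<comment> \<open>G vanishes off S only almost everywhere. Multiplying by the indicator makes this
    hold at every point and keeps the almost everywhere equality, since the indicator is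
    idempotent.\<close>
  define F' where "F' = (\<lambda>x. indicator S x *\<^sub>R G x)"
  have [measurable]: "F' \<in> borel_measurable borel"
    unfolding F'_def by measurable
  have AE: "AE x in lborel. indicator S x *\<^sub>R F x = F' x"
    using G by eventually_elim (auto simp: F'_def indicator_def)
  have sq: "AE x in lebesgue. indicator S x * (cmod (F x))\<^sup>2 = (cmod (F' x))\<^sup>2"
    using AE_completion[OF AE] by eventually_elim (auto simp: indicator_def split: if_splits)
  have m: "(\<lambda>x. (cmod (F' x))\<^sup>2) \<in> borel_measurable lebesgue"
    by (rule measurable_completion) measurable
  have "integrable lebesgue (\<lambda>x. indicator S x * (cmod (F x))\<^sup>2)"
    using F unfolding L2_on_def by blast
  then have "integrable lebesgue (\<lambda>x. (cmod (F' x))\<^sup>2)"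
    using m sq by (rule integrable_cong_AE_imp)
  then have "integrable lborel (\<lambda>x. (cmod (F' x))\<^sup>2)"
    by (subst (asm) integrable_completion) measurable
  with AE show ?thesis
    by (intro that[of F']) (simp_all add: F'_def)
qed

text \<open>The spectrum is reflected so that \<open>f\<close> is the forward transform \<^const>\<open>fourier\<close> of it.\<close>

definition PW2_spectrum :: "real \<Rightarrow> (complex \<Rightarrow> complex) \<Rightarrow> (real \<Rightarrow> complex) \<Rightarrow> bool" where
  "PW2_spectrum B f H \<longleftrightarrow> integrable lborel H \<and> integrable lborel (\<lambda>\<xi>. (cmod (H \<xi>))\<^sup>2) \<and>
    (\<forall>\<xi>. \<xi> \<notin> {-B..B} \<longrightarrow> H \<xi> = 0) \<and>
    (\<forall>z. f z = (LINT \<xi>|lborel. H \<xi> * exp (- 2 * pi * \<i> * \<xi> * z)))"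

lemma PW2_spectrum_fourier:
  assumes "PW2_spectrum B f H"
  shows "f (complex_of_real t) = fourier H t"
proof -
  have "f t = (LINT \<xi>|lborel. H \<xi> * exp (- 2 * pi * \<i> * \<xi> * complex_of_real t))"
    using assms unfolding PW2_spectrum_def by blast
  then show ?thesis
    unfolding fourier_def by (simp add: cis_conv_exp mult_ac)
qed

lemma PW2_ex_spectrum:
  assumes "f \<in> PW2 B"
  obtains H where "PW2_spectrum B f H"
proof -
  obtain F where F: "L2_on {-B..B} F"
    and f: "\<And>z. f z = (LINT \<xi>:{-B..B}|lebesgue. F \<xi> * exp (2 * pi * \<i> * complex_of_real \<xi> * z))"
    using assms unfolding PW2_def by blast
  obtain F' where [measurable]: "F' \<in> borel_measurable borel"
    and F': "AE x in lborel. indicator {-B..B} x *\<^sub>R F x = F' x" "integrable lborel (\<lambda>x. (cmod (F' x))\<^sup>2)"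
      "\<And>x. x \<notin> {-B..B} \<Longrightarrow> F' x = 0"
    by (rule L2_on_ex_borel_measurable[OF F]) auto
  define H where "H = (\<lambda>\<xi>. F' (0 - \<xi>))"
  have [measurable]: "H \<in> borel_measurable borel"
    unfolding H_def by measurable
  have H2: "integrable lborel (\<lambda>\<xi>. (cmod (H \<xi>))\<^sup>2)"
    unfolding H_def using F'(2) lborel_integrable_reflect_iff[of "\<lambda>x. (cmod (F' x))\<^sup>2" 0] by blast
  have supp: "H \<xi> = 0" if "\<xi> \<notin> {-B..B}" for \<xi>
    using that F'(3)[of "- \<xi>"] by (auto simp: H_def)
  \<comment> \<open>On a bounded interval L^2 is contained in L^1: H is its own product with the
    square-integrable indicator of the interval.\<close>
  have "integrable lborel (\<lambda>\<xi>. H \<xi> * indicator {-B..B} \<xi>)"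
  proof (rule integrable_mult_L2)
    have "(\<lambda>\<xi>. (cmod (indicator {-B..B} \<xi>))\<^sup>2) = (indicator {-B..B} :: real \<Rightarrow> real)"
      by (auto simp: indicator_def)
    then show "integrable lborel (\<lambda>\<xi>. (cmod (indicator {-B..B} \<xi>))\<^sup>2)"
      by (simp add: integrable_indicator_iff emeasure_lborel_Icc_eq)
  qed (use H2 in auto)
  also have "(\<lambda>\<xi>. H \<xi> * indicator {-B..B} \<xi>) = H"
    using supp by (auto simp: fun_eq_iff split: split_indicator)
  finally have H1: "integrable lborel H" .
  have fz: "f z = (LINT \<xi>|lborel. H \<xi> * exp (- 2 * pi * \<i> * \<xi> * z))" for z
  proof -
    have "f z = (LINT \<xi>|lebesgue. F' \<xi> * exp (2 * pi * \<i> * complex_of_real \<xi> * z))"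
      unfolding f set_lebesgue_integral_def
    proof (rule integral_cong_AE)
      have eq: "(\<lambda>\<xi>. indicator {-B..B} \<xi> *\<^sub>R (F \<xi> * exp (2 * pi * \<i> * complex_of_real \<xi> * z))) =
         (\<lambda>\<xi>. (indicator {-B..B} \<xi> *\<^sub>R F \<xi>) * exp (2 * pi * \<i> * complex_of_real \<xi> * z))"
        by simp
      have m: "(\<lambda>\<xi>. exp (2 * pi * \<i> * complex_of_real \<xi> * z)) \<in> borel_measurable lebesgue"
        by (rule measurable_completion) (auto intro!: borel_measurable_continuous_onI continuous_intros)
      show "(\<lambda>\<xi>. indicator {-B..B} \<xi> *\<^sub>R (F \<xi> * exp (2 * pi * \<i> * complex_of_real \<xi> * z))) \<in> borel_measurable lebesgue"
        unfolding eq using F m unfolding L2_on_def by (intro borel_measurable_times) auto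
      show "(\<lambda>\<xi>. F' \<xi> * exp (2 * pi * \<i> * complex_of_real \<xi> * z)) \<in> borel_measurable lebesgue"
        using m by (intro borel_measurable_times measurable_completion) auto
      show "AE \<xi> in lebesgue. indicator {-B..B} \<xi> *\<^sub>R (F \<xi> * exp (2 * pi * \<i> * complex_of_real \<xi> * z)) =
          F' \<xi> * exp (2 * pi * \<i> * complex_of_real \<xi> * z)"
        using AE_completion[OF F'(1)] by eventually_elim (metis mult_scaleR_left)
    qed
    also have "\<dots> = (LINT \<xi>|lborel. F' \<xi> * exp (2 * pi * \<i> * complex_of_real \<xi> * z))"
      by (intro integral_completion) measurable
    also have "\<dots> = (LINT \<xi>|lborel. F' (0 - \<xi>) * exp (2 * pi * \<i> * complex_of_real (0 - \<xi>) * z))"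
      by (rule lborel_integral_reflect[symmetric])
    finally show ?thesis by (simp add: H_def)
  qed
  have "PW2_spectrum B f H"
    unfolding PW2_spectrum_def using H1 H2 supp fz by (intro conjI allI impI)
  then show ?thesis
    by (rule that)
qed

text \<open>Bounded spectrum allows the exponential to be expanded under the integral, which gives
  one power series for f that converges in the whole plane.\<close>

lemma PW2_holomorphic:
  assumes "f \<in> PW2 B"
  shows "f holomorphic_on UNIV"
proof -
  obtain H where "PW2_spectrum B f H"
    using PW2_ex_spectrum[OF assms] .
  then have H: "integrable lborel H" and supp: "\<xi> \<notin> {-B..B} \<Longrightarrow> H \<xi> = 0"
    and f: "f z = (LINT \<xi>|lborel. H \<xi> * exp (- 2 * pi * \<i> * \<xi> * z))" for \<xi> z
    unfolding PW2_spectrum_def by blast+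
  have [measurable]: "H \<in> borel_measurable borel"
    using H by auto
  define a where "a = (\<lambda>n. LINT \<xi>|lborel. H \<xi> * ((- 2 * pi * \<i> * \<xi>) ^ n / fact n))"
  have sums: "(\<lambda>n. a n * z ^ n) sums f z" for z
  proof -
    \<comment> \<open>M bounds the modulus of the exponent on the support of H, so the n-th term is
      dominated by M^n / n! times |H|; the exponential series then justifies exchanging sum and
      integral.\<close>
    define M where "M = 2 * pi * \<bar>B\<bar> * cmod z"
    let ?t = "\<lambda>n \<xi>. H \<xi> * ((- 2 * pi * \<i> * complex_of_real \<xi> * z) ^ n / fact n)"
    have bound: "cmod (?t n \<xi>) \<le> cmod (of_real (M ^ n / fact n) * H \<xi>)" for n \<xi>
    proof (cases "\<xi> \<in> {-B..B}")
      case True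
      have "cmod (- 2 * pi * \<i> * complex_of_real \<xi> * z) \<le> M"
      proof -
        have "\<bar>\<xi>\<bar> * cmod z \<le> \<bar>B\<bar> * cmod z"
          using True by (intro mult_right_mono) auto
        then have "2 * pi * (\<bar>\<xi>\<bar> * cmod z) \<le> 2 * pi * (\<bar>B\<bar> * cmod z)"
          by (intro mult_left_mono) auto
        then show ?thesis
          unfolding M_def norm_mult by (simp only: mult.assoc) simp
      qed
      then have "cmod ((- 2 * pi * \<i> * complex_of_real \<xi> * z) ^ n / fact n) \<le> M ^ n / fact n"
        by (simp only: norm_divide norm_power norm_fact) (intro divide_right_mono power_mono; simp)
      then have "cmod (?t n \<xi>) \<le> cmod (H \<xi>) * (M ^ n / fact n)"
        unfolding norm_mult[of "H \<xi>"] by (rule mult_left_mono) simp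
      also have "\<dots> = cmod (of_real (M ^ n / fact n) * H \<xi>)"
        unfolding norm_mult norm_of_real by (simp add: M_def)
      finally show ?thesis .
    qed (simp add: supp)
    have int: "integrable lborel (?t n)" for n
    proof (rule Bochner_Integration.integrable_bound)
      show "integrable lborel (\<lambda>\<xi>. of_real (M ^ n / fact n) * H \<xi>)"
        using H by (rule integrable_mult_right)
    qed (use bound in auto)
    have "summable (\<lambda>n. M ^ n / fact n * (LINT \<xi>|lborel. cmod (H \<xi>)))"
      using summable_exp[of M] by (intro summable_mult2) (simp add: divide_inverse mult.commute)
    moreover have "norm (LINT \<xi>|lborel. cmod (?t n \<xi>)) \<le> M ^ n / fact n * (LINT \<xi>|lborel. cmod (H \<xi>))" for n
    proof -
      have M: "0 \<le> M" by (simp add: M_def)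
      have "norm (LINT \<xi>|lborel. cmod (?t n \<xi>)) = (LINT \<xi>|lborel. cmod (?t n \<xi>))"
        by (simp only: real_norm_def abs_of_nonneg integral_nonneg_AE AE_I2 norm_ge_zero)
      also have "\<dots> \<le> (LINT \<xi>|lborel. cmod (of_real (M ^ n / fact n) * H \<xi>))"
        using int H by (intro integral_mono bound integrable_norm) auto
      also have "\<dots> = M ^ n / fact n * (LINT \<xi>|lborel. cmod (H \<xi>))"
        using M by (simp add: norm_mult norm_divide norm_power)
      finally show ?thesis .
    qed
    ultimately have sm: "summable (\<lambda>n. LINT \<xi>|lborel. cmod (?t n \<xi>))"
      by (rule summable_comparison_test'[where N = 0])
    have exp: "(\<lambda>n. (w::complex) ^ n / fact n) sums exp w" for w
      using exp_converges[of w] by (simp add: scaleR_conv_of_real divide_inverse mult.commute)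
    have "AE \<xi> in lborel. summable (\<lambda>n. cmod (?t n \<xi>))"
    proof (intro AE_I2)
      fix \<xi>
      show "summable (\<lambda>n. cmod (?t n \<xi>))"
        unfolding norm_mult[of "H \<xi>"]
        using summable_norm_exp[of "- 2 * pi * \<i> * complex_of_real \<xi> * z"]
        by (intro summable_mult) (simp add: scaleR_conv_of_real divide_inverse mult.commute)
    qed
    from sums_integral[OF int this sm]
    have "(\<lambda>n. LINT \<xi>|lborel. ?t n \<xi>) sums (LINT \<xi>|lborel. (\<Sum>n. ?t n \<xi>))" .
    also have "(\<lambda>\<xi>. (\<Sum>n. ?t n \<xi>)) = (\<lambda>\<xi>. H \<xi> * exp (- 2 * pi * \<i> * \<xi> * z))"
      by (intro ext sums_unique[symmetric] sums_mult exp)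
    also have "(\<lambda>n. LINT \<xi>|lborel. ?t n \<xi>) = (\<lambda>n. a n * z ^ n)"
      unfolding a_def power_mult_distrib[of _ z]
      by (subst integral_mult_left_zero[symmetric]) (simp only: times_divide_eq_left times_divide_eq_right mult_ac)
    finally show ?thesis
      unfolding f[of z] .
  qed
  have "f holomorphic_on ball 0 r" for r
    by (rule power_series_holomorphic[where a = a]) (simp add: sums)
  then have "f field_differentiable at z" for z
    by (rule holomorphic_on_imp_differentiable_at[of f "ball 0 (cmod z + 1)"]) auto
  then show ?thesis
    by (simp add: holomorphic_on_def)
qed

section \<open>From squares on the real line to entire functions\<close>

lemma holomorphic_power2_eq_imp:
  assumes f: "f holomorphic_on UNIV" and g: "g holomorphic_on UNIV"
    and eq: "\<And>x::real. (f x)\<^sup>2 = (g x)\<^sup>2"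
  shows "f = g \<or> f = (\<lambda>z. - g z)"
proof -
  have lim: "(0::complex) islimpt \<real>"
  proof (unfold islimpt_approachable, intro allI impI)
    fix e :: real assume "0 < e"
    then show "\<exists>x'\<in>\<real>. x' \<noteq> 0 \<and> dist x' (0::complex) < e"
      by (intro bexI[of _ "of_real (e / 2)"]) auto
  qed
  have prod: "(f z)\<^sup>2 - (g z)\<^sup>2 = 0" for z
  proof (rule analytic_continuation[of "\<lambda>z. (f z)\<^sup>2 - (g z)\<^sup>2" UNIV "\<real>" 0])
    show "(\<lambda>z. (f z)\<^sup>2 - (g z)\<^sup>2) holomorphic_on UNIV"
      using f g by (intro holomorphic_intros)
  qed (use lim eq in \<open>auto elim!: Reals_cases\<close>)
  show ?thesis
  proof (cases "f = g")
    case False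
    then obtain z where z: "f z \<noteq> g z" by blast
    \<comment> \<open>The set where f - g does not vanish is open and contains z, so z is a limit
      point of it. There f + g must vanish, and the identity theorem carries this to the
      plane.\<close>
    have "f w + g w = 0" for w
    proof (rule analytic_continuation[of "\<lambda>z. f z + g z" UNIV "{z. f z - g z \<noteq> 0}" z])
      show "(\<lambda>z. f z + g z) holomorphic_on UNIV"
        using f g by (intro holomorphic_intros)
      have "continuous_on UNIV (\<lambda>z. f z - g z)"
        using f g by (intro holomorphic_on_imp_continuous_on holomorphic_intros)
      then have "open {z. f z - g z \<noteq> 0}"
        by (intro open_Collect_neq continuous_on_const)
      then show "z islimpt {z. f z - g z \<noteq> 0}"
        using z by (intro interior_limit_point) (simp add: interior_open)
      show "f w + g w = 0" if "w \<in> {z. f z - g z \<noteq> 0}" for w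
      proof -
        have "(f w - g w) * (f w + g w) = 0"
          using prod[of w] by (simp add: power2_eq_square algebra_simps)
        with that show ?thesis by simp
      qed
    qed auto
    then show ?thesis
      by (simp add: fun_eq_iff eq_neg_iff_add_eq_0)
  qed simp
qed

text \<open>The set of disagreement is open, and a nonempty open set is not null.\<close>

lemma AE_lborel_eq_imp_eq:
  fixes f g :: "real \<Rightarrow> 'a :: t2_space"
  assumes AE: "AE x in lborel. f x = g x" and cont: "continuous_on UNIV f" "continuous_on UNIV g"
  shows "f = g"
proof (rule ccontr)
  assume "f \<noteq> g"
  then have ne: "{x. f x \<noteq> g x} \<noteq> {}" by auto
  have op: "open {x. f x \<noteq> g x}"
    using cont by (intro open_Collect_neq)
  have "{x. f x \<noteq> g x} \<in> null_sets lborel"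
    using AE op by (subst AE_iff_null_sets) auto
  then have "negligible {x. f x \<noteq> g x}"
    unfolding negligible_iff_null_sets by (rule null_sets_completionI)
  then show False
    using open_not_negligible[OF op ne] by contradiction
qed

section \<open>The short-time Fourier transform as the Fourier transform of windowed
  products\<close>

text \<open>P may fail to be measurable, so the affine invariance is applied to a null set covering
  its exceptions.\<close>

lemma AE_lborel_shift:
  assumes "AE x in lborel. P (x::real)"
  shows "AE x in lborel. P (x - u)"
proof -
  obtain N where N: "N \<in> null_sets lborel" "{x. \<not> P x} \<subseteq> N"
    using assms by (auto simp: eventually_ae_filter)
  have "AE x in lborel. x \<notin> N"
    using N(1) by (rule AE_not_in)
  then have "AE x in lborel. - u + 1 * x \<notin> N"
    using N(1) by (intro AE_borel_affine[where P = "\<lambda>x. x \<notin> N"]) auto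
  then show ?thesis
    by eventually_elim (use N(2) in auto)
qed

text \<open>Both slots admit a representative: the ambiguity function has the window, which is only
  Lebesgue measurable, as its signal too.\<close>

lemma stft_eq_fourier:
  assumes [measurable]: "f \<in> borel_measurable borel" "\<phi>' \<in> borel_measurable borel"
    and f: "AE t in lborel. f t = f' t" and AE: "AE t in lborel. \<phi> t = \<phi>' t"
  shows "stft \<phi> f' x \<omega> = fourier (\<lambda>t. f t * cnj (\<phi>' (t - x))) \<omega>"
proof -
  have "AE t in lborel. f' t * cnj (\<phi> (t - x)) * exp (- 2 * pi * \<i> * complex_of_real (t * \<omega>)) =
      f t * cnj (\<phi>' (t - x)) * cis (- 2 * pi * t * \<omega>)"
    using AE_lborel_shift[OF AE, of x] f
    by eventually_elim (simp add: cis_conv_exp mult_ac)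
  then have AE: "AE t in lebesgue. f' t * cnj (\<phi> (t - x)) * exp (- 2 * pi * \<i> * complex_of_real (t * \<omega>)) =
      f t * cnj (\<phi>' (t - x)) * cis (- 2 * pi * t * \<omega>)"
    by (rule AE_completion)
  have m: "(\<lambda>t. f t * cnj (\<phi>' (t - x)) * cis (- 2 * pi * t * \<omega>)) \<in> borel_measurable lebesgue"
    by (rule measurable_completion) measurable
  have "stft \<phi> f' x \<omega> = (LINT t|lebesgue. f t * cnj (\<phi>' (t - x)) * cis (- 2 * pi * t * \<omega>))"
    unfolding stft_def
  proof (rule integral_cong_AE[OF _ m AE])
    have AE': "AE t in lebesgue. f t * cnj (\<phi>' (t - x)) * cis (- 2 * pi * t * \<omega>) =
       f' t * cnj (\<phi> (t - x)) * exp (- 2 * pi * \<i> * complex_of_real (t * \<omega>))"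
      using AE by eventually_elim simp
    from m AE' show "(\<lambda>t. f' t * cnj (\<phi> (t - x)) * exp (- 2 * pi * \<i> * complex_of_real (t * \<omega>))) \<in> borel_measurable lebesgue"
      by (rule borel_measurable_AE)
  qed
  also have "\<dots> = fourier (\<lambda>t. f t * cnj (\<phi>' (t - x))) \<omega>"
    unfolding fourier_def by (intro integral_completion) measurable
  finally show ?thesis .
qed

text \<open>Compact support puts the spectrum H into L^1 as well as L^2: the former bounds f on the
  line, the latter makes f square-integrable there, by Plancherel applied to H.\<close>

lemma PW2_restriction:
  assumes "PW2_spectrum B f H"
  shows "(\<lambda>t::real. f t) \<in> borel_measurable borel"
    and "cmod (f (complex_of_real t)) \<le> (LINT \<xi>|lborel. cmod (H \<xi>))"
    and "integrable lborel (\<lambda>t::real. (cmod (f t))\<^sup>2)"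
proof -
  have H: "integrable lborel H" "integrable lborel (\<lambda>\<xi>. (cmod (H \<xi>))\<^sup>2)"
    using assms unfolding PW2_spectrum_def by blast+
  have eq: "(\<lambda>t::real. f t) = fourier H"
    using PW2_spectrum_fourier[OF assms] by (rule ext)
  show "(\<lambda>t::real. f t) \<in> borel_measurable borel"
    unfolding eq using H(1) by (intro borel_measurable_fourier) auto
  show "cmod (f (complex_of_real t)) \<le> (LINT \<xi>|lborel. cmod (H \<xi>))"
    unfolding PW2_spectrum_fourier[OF assms] by (rule norm_fourier_le)
  show "integrable lborel (\<lambda>t::real. (cmod (f t))\<^sup>2)"
    unfolding PW2_spectrum_fourier[OF assms] by (rule plancherel[OF H])
qed

text \<open>These are the two hypotheses of \<open>plancherel\<close> at fixed x: two L^2 factors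
  give L^1, and boundedness of f gives L^2.\<close>

lemma integrable_window_product:
  assumes f: "PW2_spectrum B f H"
    and [measurable]: "\<phi> \<in> borel_measurable borel" and \<phi>: "integrable lborel (\<lambda>t. (cmod (\<phi> t))\<^sup>2)"
  shows "integrable lborel (\<lambda>t. f (complex_of_real t) * cnj (\<phi> (t - x)))"
    and "integrable lborel (\<lambda>t. (cmod (f (complex_of_real t) * cnj (\<phi> (t - x))))\<^sup>2)"
proof -
  note [measurable] = PW2_restriction(1)[OF f]
  have \<phi>x: "integrable lborel (\<lambda>t. (cmod (\<phi> (t - x)))\<^sup>2)"
    using \<phi> lborel_integrable_shift_iff[of "\<lambda>t. (cmod (\<phi> t))\<^sup>2" x] by simp
  show "integrable lborel (\<lambda>t. f (complex_of_real t) * cnj (\<phi> (t - x)))"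
    using PW2_restriction(3)[OF f] \<phi>x by (intro integrable_mult_L2) auto
  define C where "C = (LINT \<xi>|lborel. cmod (H \<xi>))"
  show "integrable lborel (\<lambda>t. (cmod (f (complex_of_real t) * cnj (\<phi> (t - x))))\<^sup>2)"
  proof (rule Bochner_Integration.integrable_bound)
    show "integrable lborel (\<lambda>t. C\<^sup>2 * (cmod (\<phi> (t - x)))\<^sup>2)"
      using \<phi>x by (rule integrable_mult_right)
    have "(cmod (f (complex_of_real t)))\<^sup>2 * (cmod (\<phi> (t - x)))\<^sup>2 \<le> C\<^sup>2 * (cmod (\<phi> (t - x)))\<^sup>2" for t
      unfolding C_def by (intro mult_right_mono power_mono PW2_restriction(2)[OF f]) auto
    then show "AE t in lborel. norm ((cmod (f (complex_of_real t) * cnj (\<phi> (t - x))))\<^sup>2) \<le> norm (C\<^sup>2 * (cmod (\<phi> (t - x)))\<^sup>2)"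
      by (intro AE_I2) (simp add: norm_mult power_mult_distrib)
  qed measurable
qed

lemma stft_PW2_eq_fourier:
  assumes f: "PW2_spectrum B f H" and [measurable]: "\<phi>' \<in> borel_measurable borel"
    and AE: "AE t in lborel. \<phi> t = \<phi>' t"
  shows "stft \<phi> (\<lambda>t. f (complex_of_real t)) x \<omega> = fourier (\<lambda>t. f (complex_of_real t) * cnj (\<phi>' (t - x))) \<omega>"
  using PW2_restriction(1)[OF f] assms(2) AE by (intro stft_eq_fourier) auto

text \<open>At x = 0 the phase is 1 and the window meets its own conjugate, so the hypothesis on the
  window is about the transform of its squared modulus.\<close>

lemma ambiguity_0_eq_fourier:
  assumes "\<phi>' \<in> borel_measurable borel" "AE t in lborel. \<phi> t = \<phi>' t"
  shows "ambiguity \<phi> 0 \<omega> = fourier (\<lambda>t. of_real ((cmod (\<phi>' t))\<^sup>2)) \<omega>"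
proof -
  have "AE t in lborel. \<phi>' t = \<phi> t"
    using assms(2) by eventually_elim simp
  then have "stft \<phi> \<phi> 0 \<omega> = fourier (\<lambda>t. \<phi>' t * cnj (\<phi>' (t - 0))) \<omega>"
    using assms by (intro stft_eq_fourier) auto
  then show ?thesis
    unfolding ambiguity_def by (simp only: complex_norm_square) simp
qed

theorem theorem2p2:
  fixes B :: real and \<phi> :: "real \<Rightarrow> complex" and f g :: "complex \<Rightarrow> complex"
  assumes "B > 0"
    and "L2 \<phi>"
    and "AE \<omega> in lebesgue. \<omega> \<in> {-2*B<..<2*B} \<longrightarrow> ambiguity \<phi> 0 \<omega> \<noteq> 0"
    and "f \<in> PW2 B" and "g \<in> PW2 B"
    and "\<forall>x::real. f (complex_of_real x) \<in> \<real>"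
    and "\<forall>x::real. g (complex_of_real x) \<in> \<real>"
  shows "(f = g \<or> f = (\<lambda>z. - g z)) \<longleftrightarrow>
    (\<forall>x \<omega>. cmod (stft \<phi> (\<lambda>t. f (complex_of_real t)) x \<omega>)
          = cmod (stft \<phi> (\<lambda>t. g (complex_of_real t)) x \<omega>))"
proof
  assume "f = g \<or> f = (\<lambda>z. - g z)"
  then show "\<forall>x \<omega>. cmod (stft \<phi> (\<lambda>t. f (complex_of_real t)) x \<omega>)
          = cmod (stft \<phi> (\<lambda>t. g (complex_of_real t)) x \<omega>)"
    by (auto simp: stft_def)
next
  assume eq: "\<forall>x \<omega>. cmod (stft \<phi> (\<lambda>t. f (complex_of_real t)) x \<omega>)
          = cmod (stft \<phi> (\<lambda>t. g (complex_of_real t)) x \<omega>)"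
  obtain \<phi>' where \<phi>'[measurable]: "\<phi>' \<in> borel_measurable borel" and AE\<phi>: "AE x in lborel. indicator UNIV x *\<^sub>R \<phi> x = \<phi>' x"
    and \<phi>2: "integrable lborel (\<lambda>x. (cmod (\<phi>' x))\<^sup>2)"
    by (rule L2_on_ex_borel_measurable[OF assms(2)]) auto
  have \<phi>: "AE x in lborel. \<phi> x = \<phi>' x"
    using AE\<phi> by simp
  obtain F where F: "PW2_spectrum B f F"
    using PW2_ex_spectrum[OF assms(4)] .
  obtain G where G: "PW2_spectrum B g G"
    using PW2_ex_spectrum[OF assms(5)] .
  note [measurable] = PW2_restriction(1)[OF F] PW2_restriction(1)[OF G]
  have real: "(f t)\<^sup>2 = of_real ((cmod (f t))\<^sup>2)" "(g t)\<^sup>2 = of_real ((cmod (g t))\<^sup>2)" for t :: real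
    using assms(6,7) by (auto elim!: Reals_cases allE[of _ t] simp flip: of_real_power)
  define e where "e = (\<lambda>t::real. (cmod (f t))\<^sup>2 - (cmod (g t))\<^sup>2)"
  \<comment> \<open>\<open>fourier\<close> takes complex functions, while the final positivity
    argument needs the real-valued \<open>e\<close>.\<close>
  define d where "d = (\<lambda>t. complex_of_real (e t))"
  define p where "p = (\<lambda>t. complex_of_real ((cmod (\<phi>' t))\<^sup>2))"
  have e: "integrable lborel e"
    unfolding e_def using PW2_restriction(3)[OF F] PW2_restriction(3)[OF G] by (rule Bochner_Integration.integrable_diff)
  then have d: "integrable lborel d"
    unfolding d_def by simp
  have p: "integrable lborel p"
    unfolding p_def using \<phi>2 by (simp del: of_real_power)
  have [measurable]: "e \<in> borel_measurable borel" "d \<in> borel_measurable borel"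
    using e d by auto

  \<comment> \<open>As \<open>p\<close> is real, \<open>cnj\<close> changes no value; it puts the
    integral into the form of \<open>fourier_correlation\<close>.\<close>
  have corr: "(LINT t|lborel. d t * cnj (p (t - x))) = 0" for x
  proof -
    note F' = integrable_window_product[OF F \<phi>' \<phi>2, of x] and G' = integrable_window_product[OF G \<phi>' \<phi>2, of x]
    have "(LINT t|lborel. (cmod (f (complex_of_real t) * cnj (\<phi>' (t - x))))\<^sup>2) =
        (LINT t|lborel. (cmod (g (complex_of_real t) * cnj (\<phi>' (t - x))))\<^sup>2)"
      unfolding plancherel(2)[OF F', symmetric] plancherel(2)[OF G', symmetric]
        stft_PW2_eq_fourier[OF F \<phi>' \<phi>, symmetric] stft_PW2_eq_fourier[OF G \<phi>' \<phi>, symmetric]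
      using eq by simp
    then have "(LINT t|lborel. (cmod (f (complex_of_real t) * cnj (\<phi>' (t - x))))\<^sup>2 -
        (cmod (g (complex_of_real t) * cnj (\<phi>' (t - x))))\<^sup>2) = 0"
      unfolding Bochner_Integration.integral_diff[OF F'(2) G'(2)] by (rule right_minus_eq[THEN iffD2])
    moreover have "d t * cnj (p (t - x)) = of_real ((cmod (f (complex_of_real t) * cnj (\<phi>' (t - x))))\<^sup>2 -
        (cmod (g (complex_of_real t) * cnj (\<phi>' (t - x))))\<^sup>2)" for t
      by (simp add: d_def e_def p_def norm_mult power_mult_distrib algebra_simps)
    ultimately show ?thesis
      by (simp only: integral_complex_of_real of_real_0)
  qed

  have zero: "AE \<eta> in lborel. \<eta> \<in> {-2*B<..<2*B} \<longrightarrow> fourier d \<eta> = 0"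
  proof -
    have *: "fourier d \<eta> * cnj (fourier p \<eta>) = 0" for \<eta>
      unfolding fourier_correlation[OF d p, symmetric] corr by (simp add: fourier_def)
    have "AE \<eta> in lborel. \<eta> \<in> {-2*B<..<2*B} \<longrightarrow> ambiguity \<phi> 0 \<eta> \<noteq> 0"
      using assms(3) by (simp only: AE_completion_iff)
    then show ?thesis
    proof eventually_elim
      case (elim \<eta>)
      then show ?case
        using *[of \<eta>] unfolding ambiguity_0_eq_fourier[OF \<phi>' \<phi>] p_def by auto
    qed
  qed

  \<comment> \<open>The assumption \<open>hr\<close> replaces the squared modulus by the
    unconjugated square of \<open>fourier H\<close>, the form that the band-limited pairing
    requires.\<close>
  have orth: "(LINT t|lborel. e t * (cmod (h (complex_of_real t)))\<^sup>2) = 0"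
    if H: "PW2_spectrum B h H" and hr: "\<And>t::real. (h t)\<^sup>2 = of_real ((cmod (h t))\<^sup>2)" for h H
  proof -
    have "complex_of_real (LINT t|lborel. e t * (cmod (h (complex_of_real t)))\<^sup>2) =
        (LINT t|lborel. d t * (fourier H t * fourier H t))"
      unfolding integral_complex_of_real[symmetric] PW2_spectrum_fourier[OF H, symmetric]
      by (simp add: d_def hr flip: power2_eq_square of_real_power)
    also have "\<dots> = 0"
      using H zero unfolding PW2_spectrum_def by (intro integral_mult_band_limited_eq_0[OF d]) auto
    finally show ?thesis by (simp only: of_real_eq_0_iff)
  qed
  have int: "integrable lborel (\<lambda>t. e t * (cmod (h (complex_of_real t)))\<^sup>2)" if H: "PW2_spectrum B h H" for h H
  proof (rule Bochner_Integration.integrable_bound)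
    note [measurable] = PW2_restriction(1)[OF H]
    show "integrable lborel (\<lambda>t. (LINT \<xi>|lborel. cmod (H \<xi>))\<^sup>2 * e t)"
      using e by (rule integrable_mult_right)
    show "(\<lambda>t. e t * (cmod (h (complex_of_real t)))\<^sup>2) \<in> borel_measurable lborel"
      by measurable
    have "\<bar>e t\<bar> * (cmod (h (complex_of_real t)))\<^sup>2 \<le> \<bar>e t\<bar> * (LINT \<xi>|lborel. cmod (H \<xi>))\<^sup>2" for t
      by (intro mult_left_mono power_mono PW2_restriction(2)[OF H]) auto
    then show "AE t in lborel. norm (e t * (cmod (h (complex_of_real t)))\<^sup>2) \<le> norm ((LINT \<xi>|lborel. cmod (H \<xi>))\<^sup>2 * e t)"
      by (intro AE_I2) (simp add: abs_mult mult.commute)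
  qed
  \<comment> \<open>Expanding one factor of the square writes its integral as a difference of two
    vanishing pairings.\<close>
  have e2: "(\<lambda>t. (e t)\<^sup>2) = (\<lambda>t. e t * (cmod (f t))\<^sup>2 - e t * (cmod (g t))\<^sup>2)"
    by (simp add: e_def power2_eq_square algebra_simps)
  have "integrable lborel (\<lambda>t. (e t)\<^sup>2)"
    unfolding e2 using int[OF F] int[OF G] by (rule Bochner_Integration.integrable_diff)
  moreover have "(LINT t|lborel. (e t)\<^sup>2) = 0"
    unfolding e2 Bochner_Integration.integral_diff[OF int[OF F] int[OF G]] orth[OF F real(1)] orth[OF G real(2)] by simp
  ultimately have "AE t in lborel. (e t)\<^sup>2 = 0"
    by (subst (asm) integral_nonneg_eq_0_iff_AE) auto
  then have "AE t in lborel. (f (complex_of_real t))\<^sup>2 = (g (complex_of_real t))\<^sup>2"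
    unfolding real by eventually_elim (simp add: e_def)
  \<comment> \<open>Continuity upgrades the almost everywhere identity to every real point, as the
    identity theorem requires.\<close>
  moreover have "continuous_on UNIV (\<lambda>t::real. h t)" if "h holomorphic_on UNIV" for h :: "complex \<Rightarrow> complex"
    by (rule continuous_on_compose2[OF holomorphic_on_imp_continuous_on[OF that] continuous_on_of_real[OF continuous_on_id]]) simp
  moreover note hol = PW2_holomorphic[OF assms(4)] PW2_holomorphic[OF assms(5)]
  ultimately have "(\<lambda>t::real. (f t)\<^sup>2) = (\<lambda>t::real. (g t)\<^sup>2)"
    by (intro AE_lborel_eq_imp_eq continuous_on_power) blast+
  then show "f = g \<or> f = (\<lambda>z. - g z)"
    by (intro holomorphic_power2_eq_imp hol) (simp add: fun_eq_iff)
qed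

end
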